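(* Let $\varrho(n)$ denote the number of integers $a$ with $1\le a\le n$ for which there exists an integer $x$ with $a^2x\equiv a\pmod n$, and let $\phi$ be Euler's totient function. Then \[ \limsup_{n\to\infty}\frac{\varrho(n)}{\phi(n)\log\log n}=e^{\gamma}, \] where $\gamma$ is Euler's constant.
   Context: An integer $a$ is called regular (mod $n$) if there is an integer $x$ with $a^2x\equiv a \pmod n$; $\varrho(n)$ counts regular integers (mod $n$) in $\{1,\dots,n\}$. Equivalently, $\varrho$ is multiplicative with $\varrho(p^\nu)=p^\nu-p^{\nu-1}+1$ for prime powers. *)

theory Defs
  imports
    "HOL-Analysis.Analysis"
    "HOL-Number_Theory.Number_Theory"
begin

definition regular_mod :: "int \<Rightarrow> int \<Rightarrow> bool" where
  "regular_mod n a \<longleftrightarrow> (\<exists>x. [a\<^sup>2 * x = a] (mod n))"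

definition varrho :: "nat \<Rightarrow> nat" where
  "varrho n = card {a \<in> {1..int n}. regular_mod (int n) a}"

end

theory Submission
  imports
    Defs
    "HOL-Computational_Algebra.Squarefree"
    "HOL-Real_Asymp.Real_Asymp"
begin

text \<open>
  Trivially \<open>\<rho>(n) \<le> n\<close>, with equality for squarefree \<open>n\<close>, since every \<open>a\<close>
  is then a unit modulo \<open>n / gcd(a, n)\<close>. So it suffices to bound \<open>n / \<phi>(n)\<close> from above in general and from below on primorials.
  Both bounds reduce to Mertens' third theorem \<open>\<Prod>\<^bsub>p \<le> x\<^esub> (1 - 1/p)\<^sup>-\<^sup>1 \<sim> e\<^sup>\<gamma> ln x\<close>: the prime factors of \<open>n\<close>
  above \<open>ln n\<close> are too few to matter, and the primorial of \<open>x\<close> is at most \<open>4\<^sup>x\<close>.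

  The constant in Mertens' theorem is found by comparing Dirichlet series with power series. Let
  \<open>d\<^sub>k\<close> be the sum of \<open>- ln (1 - 1/p)\<close> over the primes in \<open>(2\<^sup>k, 2\<^sup>k\<^sup>+\<^sup>1]\<close>. Mertens' first theorem and
  summation by parts show that \<open>\<Sum> (d\<^sub>k - 1/(k+1))\<close> converges. At \<open>z = 2\<^sup>-\<^sup>\<sigma>\<close>, the series
  \<open>\<Sum> d\<^sub>k z\<^sup>k\<^sup>+\<^sup>1\<close> is \<open>ln \<zeta>(1 + \<sigma>) + o(1) = - ln \<sigma> + o(1)\<close> as \<open>\<sigma>\<close> tends to 0, while
  \<open>\<Sum> z\<^sup>k\<^sup>+\<^sup>1/(k+1) = - ln (1 - z)\<close>, so by Abel's limit theorem the sum is \<open>ln ln 2\<close>. The partial sums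
  of \<open>\<Sum> 1/(k+1)\<close> contribute \<open>\<gamma>\<close>.
\<close>

section \<open>Chebyshev's bound and Mertens' first theorem\<close>

definition primorial :: "nat \<Rightarrow> nat" where
  "primorial n = \<Prod>{p. prime p \<and> p \<le> n}"

text \<open>The logarithm of the inverse Euler factor at a prime, extended by 0 so that sums over
  primes can be written as sums over all naturals.\<close>

definition euler_log :: "nat \<Rightarrow> real" where
  "euler_log n = (if prime n then - ln (1 - 1 / real n) else 0)"

lemma finite_primes_le [simp]: "finite {p::nat. prime p \<and> p \<le> n}"
  by (rule finite_subset[of _ "{..n}"]) auto

lemma primorial_pos: "primorial n > 0"
  by (auto simp: primorial_def prod_pos prime_gt_0_nat)

lemma prod_primes_dvd:
  fixes m :: nat
  assumes "finite P" "\<And>p. p \<in> P \<Longrightarrow> prime p \<and> p dvd m"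
  shows "\<Prod>P dvd m"
  using assms
proof (induction P rule: finite_induct)
  case (insert q P)
  have "coprime q (\<Prod>P)"
    by (rule prod_coprime_right) (use insert in \<open>auto intro: primes_coprime\<close>)
  with insert show ?case by (auto intro: divides_mult)
qed auto

text \<open>By symmetry this coefficient occurs twice in row 2m + 1, whose total is twice
  4^m.\<close>

lemma binomial_odd_le: "(2 * m + 1) choose m \<le> 4 ^ m"
proof -
  have "2 * ((2 * m + 1) choose m) = ((2 * m + 1) choose m) + ((2 * m + 1) choose (m + 1))"
    using binomial_symmetric[of m "2 * m + 1"] by simp
  also have "\<dots> = (\<Sum>k\<in>{m, m + 1}. (2 * m + 1) choose k)"
    by simp
  also have "\<dots> \<le> (\<Sum>k\<le>2 * m + 1. (2 * m + 1) choose k)"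
    by (rule sum_mono2) auto
  also have "\<dots> = 2 * 4 ^ m"
    by (subst choose_row_sum) (simp add: power_mult)
  finally show ?thesis by simp
qed

text \<open>Erdos' induction. An even n > 2 adds no prime. For n = 2m + 1 the primes in (m + 1, n]
  all divide \<open>n choose m\<close>, which is at most 4^m, and the primes up to m + 1 are covered
  by the induction hypothesis.\<close>

lemma primorial_le: "primorial n \<le> 4 ^ n"
proof (induction n rule: less_induct)
  case (less n)
  consider "n = 0" | "n = 1" | "n = 2" | "n > 2" "even n" | "n > 2" "odd n" by linarith
  then show ?case
  proof cases
    case 1
    then have "{p::nat. prime p \<and> p \<le> n} = {}" by auto
    then show ?thesis by (simp only: primorial_def) simp
  next
    case 2
    then have "{p::nat. prime p \<and> p \<le> n} = {}" by (auto dest: prime_gt_1_nat)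
    then show ?thesis by (simp only: primorial_def) simp
  next
    case 3
    then have "{p::nat. prime p \<and> p \<le> n} = {2}"
      by (auto dest: prime_gt_1_nat)
    with 3 show ?thesis by (simp add: primorial_def)
  next
    case 4
    have "\<not> prime n" using 4 prime_odd_nat by blast
    then have "{p. prime p \<and> p \<le> n} = {p. prime p \<and> p \<le> n - 1}"
      using 4 by (metis (no_types, lifting) One_nat_def Suc_pred le_SucE le_SucI
          less_imp_Suc_add zero_less_Suc)
    then have "primorial n = primorial (n - 1)" by (simp add: primorial_def)
    also have "\<dots> \<le> 4 ^ (n - 1)" using 4 by (intro less) auto
    also have "\<dots> \<le> 4 ^ n" by (intro power_increasing) auto
    finally show ?thesis .
  next
    case 5
    then obtain m where m: "n = 2 * m + 1" by (auto elim: oddE)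
    with 5 have "m \<ge> 1" by auto
    have decomp: "{p. prime p \<and> p \<le> n} =
        {p. prime p \<and> p \<le> m + 1} \<union> {p. prime p \<and> m + 1 < p \<and> p \<le> n}"
      using m by auto
    have fin: "finite {p. prime p \<and> m + 1 < p \<and> p \<le> n}"
      by (rule finite_subset[of _ "{..n}"]) auto
    have "\<Prod>{p. prime p \<and> m + 1 < p \<and> p \<le> n} dvd n choose m"
    proof (rule prod_primes_dvd[OF fin])
      fix p assume p: "p \<in> {p. prime p \<and> m + 1 < p \<and> p \<le> n}"
      have "fact m * fact (n - m) * (n choose m) = (fact n :: nat)"
        using m by (intro binomial_fact_lemma) auto
      \<comment> \<open>p exceeds both m and n - m = m + 1, so it survives the division of n! by m!
        (n - m)!.\<close>
      moreover have "p dvd fact n" "\<not> p dvd fact m" "\<not> p dvd fact (n - m)"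
        using p m by (auto simp: prime_dvd_fact_iff simp del: fact_Suc)
      ultimately show "prime p \<and> p dvd n choose m"
        using p by (metis (mono_tags, lifting) mem_Collect_eq prime_dvd_mult_iff)
    qed
    then have "\<Prod>{p. prime p \<and> m + 1 < p \<and> p \<le> n} \<le> n choose m"
      using m by (intro dvd_imp_le) auto
    also have "\<dots> \<le> 4 ^ m" using binomial_odd_le m by simp
    finally have "primorial n \<le> primorial (m + 1) * 4 ^ m"
      unfolding primorial_def decomp
      by (subst prod.union_disjoint) (use fin in auto)
    also have "\<dots> \<le> 4 ^ (m + 1) * 4 ^ m"
      using \<open>m \<ge> 1\<close> m by (intro mult_right_mono less) auto
    also have "\<dots> = 4 ^ n" using m by (simp add: power_add [symmetric] mult_2)
    finally show ?thesis .
  qed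
qed

text \<open>Chebyshev's function \<theta>(n) is the logarithm of the primorial.\<close>

lemma sum_ln_primes_le: "(\<Sum>p | prime p \<and> p \<le> n. ln (real p)) \<le> real n * ln 4"
proof -
  have "(\<Sum>p | prime p \<and> p \<le> n. ln (real p)) = ln (real (primorial n))"
    unfolding primorial_def of_nat_prod
    by (subst ln_prod) (auto simp: prime_gt_0_nat)
  also have "\<dots> \<le> ln (4 ^ n)"
    using primorial_le[of n] primorial_pos[of n] by (subst ln_le_cancel_iff) (auto simp flip: of_nat_le_iff)
  finally show ?thesis by (simp add: ln_realpow)
qed

section \<open>Mertens' first theorem, from the prime factorisation of n!\<close>

lemma ln_fact_mangoldt:
  "ln (fact n) = (\<Sum>d=1..n. mangoldt d * real (n div d))"
proof (induction n)
  case (Suc n)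
  \<comment> \<open>Passing from n to n + 1 raises the quotient by d exactly when d divides n + 1;
    the resulting terms are a divisor sum of \<open>mangoldt\<close>, which is ln (n + 1).\<close>
  have "(\<Sum>d=1..Suc n. mangoldt d * real (Suc n div d)) =
        (\<Sum>d=1..Suc n. mangoldt d * real (n div d) + (if d dvd Suc n then mangoldt d else 0))"
    by (intro sum.cong refl) (auto simp: div_Suc dvd_eq_mod_eq_0 algebra_simps)
  also have "\<dots> = (\<Sum>d=1..n. mangoldt d * real (n div d)) + (\<Sum>d | d dvd Suc n. mangoldt d)"
  proof -
    have "{d \<in> {1..Suc n}. d dvd Suc n} = {d. d dvd Suc n}"
      by (auto dest: dvd_imp_le simp: Suc_le_eq intro: Nat.gr0I)
    then have "(\<Sum>d=1..Suc n. if d dvd Suc n then mangoldt d else 0 :: real) = (\<Sum>d | d dvd Suc n. mangoldt d)"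
      by (subst sum.inter_filter [symmetric]) (simp_all only: finite_atLeastAtMost)
    moreover have "(\<Sum>d=1..Suc n. mangoldt d * real (n div d)) = (\<Sum>d=1..n. mangoldt d * real (n div d))"
      by simp
    ultimately show ?thesis by (simp only: sum.distrib)
  qed
  also have "\<dots> = ln (fact (Suc n))"
    using Suc by (simp add: mangoldt_sum ln_mult del: of_nat_Suc)
  finally show ?case by simp
qed simp

text \<open>A weak Stirling bound by induction: each step costs n ln (1 + 1/n) \<le> 1. The total
  error n becomes O(1) after division by n.\<close>

lemma ln_fact_ge: "ln (fact n) \<ge> real n * ln (real n) - real n"
proof (induction n)
  case (Suc n)
  show ?case
  proof (cases "n = 0")
    case False
    have "ln (1 + 1 / real n) \<le> 1 / real n" by (rule ln_add_one_self_le_self) auto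
    also have "ln (1 + 1 / real n) = ln (real (Suc n)) - ln (real n)"
    proof -
      have "1 + 1 / real n = real (Suc n) / real n" using False by (simp add: field_simps)
      then show ?thesis using False by (simp only: ln_div) simp
    qed
    finally have "real n * (ln (real (Suc n)) - ln (real n)) \<le> 1"
      using False by (simp add: field_simps)
    moreover have "ln (fact (Suc n)) = ln (real (Suc n)) + ln (fact n)"
      by (simp add: ln_mult del: of_nat_Suc)
    ultimately show ?thesis using Suc by (simp add: algebra_simps)
  qed auto
qed auto

lemma ln_fact_le: "ln (fact n) \<le> real n * ln (real n)"
proof -
  have "(fact n :: real) \<le> real n ^ n" by (metis fact_le_power of_nat_fact of_nat_le_iff of_nat_power order.refl)
  then have "ln (fact n) \<le> ln (real n ^ n)"
    by (cases "n = 0") (auto intro!: ln_mono)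
  then show ?thesis by (cases "n = 0") (auto simp: ln_realpow)
qed

text \<open>Keep only the primes in the formula for ln n!. Replacing \<open>n div p\<close> by n/p -
  1 loses at most ln p per prime, in total at most n ln 4 by Chebyshev's bound.\<close>

lemma sum_ln_prime_div_le:
  assumes "n \<ge> 1"
  shows "(\<Sum>p | prime p \<and> p \<le> n. ln (real p) / real p) \<le> ln (real n) + ln 4"
proof -
  let ?P = "{p. prime p \<and> p \<le> n}"
  have "real n * (\<Sum>p\<in>?P. ln (real p) / real p) - (\<Sum>p\<in>?P. ln (real p))
      = (\<Sum>p\<in>?P. ln (real p) * (real n / real p - 1))"
    by (simp add: sum_distrib_left algebra_simps sum_subtractf)
  also have "\<dots> \<le> (\<Sum>p\<in>?P. mangoldt p * real (n div p))"
  proof (rule sum_mono)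
    fix p assume "p \<in> ?P"
    then have "prime p" by auto
    have "real n / real p - 1 \<le> real (n div p)"
      using floor_divide_of_nat_eq[of n p, where ?'a = real] by linarith
    then show "ln (real p) * (real n / real p - 1) \<le> mangoldt p * real (n div p)"
      using \<open>prime p\<close> prime_ge_1_nat[of p] by (auto intro!: mult_left_mono)
  qed
  also have "\<dots> \<le> (\<Sum>d=1..n. mangoldt d * real (n div d))"
    by (rule sum_mono2) (auto simp: mangoldt_nonneg dest: prime_ge_1_nat)
  also have "\<dots> \<le> real n * ln (real n)" using ln_fact_le[of n] by (simp add: ln_fact_mangoldt)
  finally have "real n * (\<Sum>p\<in>?P. ln (real p) / real p) \<le> real n * (ln (real n) + ln 4)"
    using sum_ln_primes_le[of n] by (simp add: algebra_simps)
  then show ?thesis using assms by simp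
qed

text \<open>In this direction the higher prime powers in the formula for ln n! have to be kept;
  summing the geometric series over the exponents turns 1/p into 1/(p - 1).\<close>

lemma sum_ln_prime_div_ge:
  assumes "n \<ge> 1"
  shows "(\<Sum>p | prime p \<and> p \<le> n. ln (real p) / (real p - 1)) \<ge> ln (real n) - 1"
proof -
  let ?P = "{p. prime p \<and> p \<le> n}"
  let ?I = "?P \<times> {1..n}"
  let ?D = "{d \<in> {1..n}. primepow d}"
  have "real n * ln (real n) - real n \<le> (\<Sum>d=1..n. mangoldt d * real (n div d))"
    using ln_fact_ge[of n] by (simp add: ln_fact_mangoldt)
  also have "\<dots> \<le> (\<Sum>d=1..n. mangoldt d * (real n / real d))"
    by (intro sum_mono mult_left_mono of_nat_div_le_of_nat mangoldt_nonneg)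
  also have "\<dots> = real n * (\<Sum>d\<in>?D. mangoldt d / real d)"
    by (subst sum_distrib_left, intro sum.mono_neutral_cong_right) (auto simp: mangoldt_def)
  finally have "real n * (ln (real n) - 1) \<le> real n * (\<Sum>d\<in>?D. mangoldt d / real d)"
    by (simp add: algebra_simps)
  then have "ln (real n) - 1 \<le> (\<Sum>d\<in>?D. mangoldt d / real d)"
    using assms by (subst (asm) mult_le_cancel_left_pos) auto
  \<comment> \<open>The terms are nonnegative, so the range may be enlarged to all p^k with p, k
    \<le> n; over this rectangle the sum splits prime by prime.\<close>
  also have "\<dots> \<le> (\<Sum>d\<in>(\<lambda>(p,k). p ^ k) ` ?I. mangoldt d / real d)"
  proof (rule sum_mono2)
    show "?D \<subseteq> (\<lambda>(p,k). p ^ k) ` ?I"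
    proof
      fix d assume d: "d \<in> ?D"
      then obtain p k where pk: "prime p" "k > 0" "d = p ^ k"
        by (auto simp: primepow_def)
      have "p \<le> d" using pk by (auto intro: self_le_power prime_ge_1_nat)
      \<comment> \<open>The exponent stays in range because k < 2^k \<le> p^k = d.\<close>
      moreover have "k \<le> d" using pk less_exp[of k] prime_ge_2_nat[of p] power_mono[of 2 p k] by simp
      ultimately show "d \<in> (\<lambda>(p,k). p ^ k) ` ?I" using d pk by (intro image_eqI[of _ _ "(p, k)"]) auto
    qed
  qed (auto simp: mangoldt_nonneg)
  also have "\<dots> \<le> (\<Sum>(p,k)\<in>?I. ln (real p) / real p ^ k)"
    by (rule order.trans[OF sum_image_le]) (auto simp: mangoldt_nonneg intro!: sum_mono)
  also have "\<dots> = (\<Sum>p\<in>?P. ln (real p) * (\<Sum>k=1..n. (1 / real p) ^ k))"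
    by (simp add: sum.cartesian_product sum_distrib_left power_one_over field_simps)
  also have "\<dots> \<le> (\<Sum>p\<in>?P. ln (real p) * (1 / (real p - 1)))"
  proof (intro sum_mono mult_left_mono)
    fix p assume "p \<in> ?P"
    then have p: "real p > 1" using prime_gt_1_nat by auto
    have "(\<Sum>k=1..n. (1 / real p) ^ k) = (1 / real p - (1 / real p) ^ Suc n) / (1 - 1 / real p)"
      using p assms by (subst sum_gp) auto
    also have "\<dots> \<le> (1 / real p) / (1 - 1 / real p)"
      using p by (intro divide_right_mono) auto
    also have "\<dots> = 1 / (real p - 1)" using p by (simp add: field_simps)
    finally show "(\<Sum>k=1..n. (1 / real p) ^ k) \<le> 1 / (real p - 1)" .
  qed (auto dest: prime_ge_1_nat)
  finally show ?thesis by simp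
qed

lemma minus_ln_one_minus_bounds:
  fixes x :: real assumes "0 \<le> x" "x < 1"
  shows "x \<le> - ln (1 - x)" "- ln (1 - x) \<le> x / (1 - x)"
proof -
  show "x \<le> - ln (1 - x)" using ln_le_minus_one[of "1 - x"] assms by simp
  have "- ln (1 - x) = ln (1 / (1 - x))" using assms by (simp add: ln_div)
  also have "\<dots> \<le> 1 / (1 - x) - 1" using assms by (intro ln_le_minus_one) auto
  also have "\<dots> = x / (1 - x)" using assms by (simp add: field_simps)
  finally show "- ln (1 - x) \<le> x / (1 - x)" .
qed

lemma euler_log_bounds:
  assumes "prime p"
  shows "1 / real p \<le> euler_log p" "euler_log p \<le> 1 / (real p - 1)"
  using minus_ln_one_minus_bounds[of "1 / real p"] prime_gt_1_nat[OF assms] assms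
  by (auto simp: euler_log_def field_simps)

lemma euler_log_nonneg: "euler_log n \<ge> 0"
  using order.trans[OF _ euler_log_bounds(1)[of n], of 0]
  by (cases "prime n") (auto simp: euler_log_def)

text \<open>For n \<ge> 2 this is the gap between ln n / (n - 1) and ln n / n, the weights in the
  two estimates above; its convergence makes them agree up to a constant.\<close>

lemma summable_ln_over_square: "summable (\<lambda>n. ln (real n) / (real n * (real n - 1)))"
proof (rule summable_comparison_test_bigo)
  show "summable (\<lambda>n. norm (real n powr (-3/2)))" by (simp add: summable_real_powr_iff)
  show "(\<lambda>n. ln (real n) / (real n * (real n - 1))) \<in> O(\<lambda>n. real n powr (-3/2))"
    by real_asymp
qed

lemma sum_euler_log_eq: "(\<Sum>n\<le>N. euler_log n * f n) = (\<Sum>p | prime p \<and> p \<le> N. euler_log p * f p)"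
  by (intro sum.mono_neutral_right) (auto simp: euler_log_def)

text \<open>Since \<open>euler_log p\<close> lies between 1/p and 1/(p - 1), both estimates apply to
  it at the cost of the convergent sum of the gaps \<open>e\<close>.\<close>

lemma mertens_first:
  obtains C where "\<And>N. N \<ge> 1 \<Longrightarrow> \<bar>(\<Sum>n\<le>N. euler_log n * ln (real n)) - ln (real N)\<bar> \<le> C"
proof
  define e where "e = (\<lambda>n. ln (real n) / (real n * (real n - 1)))"
  have e_nonneg: "e n \<ge> 0" for n
    by (cases "n = 0") (auto simp: e_def intro!: divide_nonneg_nonneg)
  define C where "C = suminf e + ln 4 + 1"
  have e_le: "(\<Sum>p | prime p \<and> p \<le> N. e p) \<le> suminf e" for N
    using summable_ln_over_square e_nonneg unfolding e_def by (intro sum_le_suminf) auto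
  have ln4: "ln (4::real) \<ge> 0" by simp
  fix N :: nat assume N: "N \<ge> 1"
  let ?P = "{p. prime p \<and> p \<le> N}"
  have ediff: "ln (real p) / (real p - 1) = ln (real p) / real p + e p" if "p \<in> ?P" for p
    using that prime_gt_1_nat[of p] by (auto simp: e_def divide_simps) (auto simp: algebra_simps)
  have "(\<Sum>n\<le>N. euler_log n * ln (real n)) \<le> (\<Sum>p\<in>?P. ln (real p) / (real p - 1))"
    unfolding sum_euler_log_eq
  proof (rule sum_mono)
    fix p assume "p \<in> ?P"
    then show "euler_log p * ln (real p) \<le> ln (real p) / (real p - 1)"
      using mult_right_mono[OF euler_log_bounds(2)[of p], of "ln (real p)"] prime_ge_1_nat[of p] by auto
  qed
  also have "\<dots> = (\<Sum>p\<in>?P. ln (real p) / real p) + (\<Sum>p\<in>?P. e p)"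
    using ediff by (simp add: sum.distrib)
  also have "\<dots> \<le> ln (real N) + C"
    using sum_ln_prime_div_le[OF N] e_le[of N] by (simp add: C_def)
  finally have upper: "(\<Sum>n\<le>N. euler_log n * ln (real n)) \<le> ln (real N) + C" .
  have "ln (real N) - 1 \<le> (\<Sum>p\<in>?P. ln (real p) / (real p - 1))"
    using sum_ln_prime_div_ge[OF N] .
  also have "\<dots> = (\<Sum>p\<in>?P. ln (real p) / real p) + (\<Sum>p\<in>?P. e p)"
    using ediff by (simp add: sum.distrib)
  also have "\<dots> \<le> (\<Sum>n\<le>N. euler_log n * ln (real n)) + suminf e"
    unfolding sum_euler_log_eq
  proof (intro add_mono e_le sum_mono)
    fix p assume "p \<in> ?P"
    then show "ln (real p) / real p \<le> euler_log p * ln (real p)"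
      using mult_right_mono[OF euler_log_bounds(1)[of p], of "ln (real p)"] prime_ge_1_nat[of p] by auto
  qed
  finally show "\<bar>(\<Sum>n\<le>N. euler_log n * ln (real n)) - ln (real N)\<bar> \<le> C"
    using upper ln4 unfolding abs_le_iff C_def by linarith
qed

section \<open>The Euler product of the zeta function\<close>

lemma summable_on_powr:
  assumes "s > 1"
  shows "(\<lambda>n. real n powr -s) summable_on A"
proof -
  have "summable (\<lambda>n. norm (real n powr -s))"
    using assms by (simp add: summable_real_powr_iff)
  then have "(\<lambda>n. real n powr -s) summable_on UNIV"
    by (rule norm_summable_imp_summable_on)
  then show ?thesis by (rule summable_on_subset_banach) auto
qed

text \<open>
  Sieving by one more prime \<open>p\<close> removes the multiples of \<open>p\<close>, which are \<open>p\<close> times the integers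
  that survived so far. This yields the Euler product without any infinite product.
\<close>

lemma infsum_sieve_step:
  assumes "s > 1" "prime p" "p \<notin> P" "\<And>q. q \<in> P \<Longrightarrow> prime q"
  shows "infsum (\<lambda>n. real n powr -s) {n. \<forall>q\<in>insert p P. \<not> q dvd n}
       = (1 - real p powr -s) * infsum (\<lambda>n. real n powr -s) {n. \<forall>q\<in>P. \<not> q dvd n}"
proof -
  let ?f = "\<lambda>n. real n powr -s"
  let ?A = "{n. \<forall>q\<in>P. \<not> q dvd n}"
  let ?B = "{n. \<forall>q\<in>insert p P. \<not> q dvd n}"
  have img: "{n \<in> ?A. p dvd n} = (*) p ` ?A"
  proof (intro equalityI subsetI)
    fix n assume n: "n \<in> {n \<in> ?A. p dvd n}"
    then obtain m where "n = p * m" by auto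
    with n have "m \<in> ?A" by auto
    with \<open>n = p * m\<close> show "n \<in> (*) p ` ?A" by blast
  next
    fix n assume "n \<in> (*) p ` ?A"
    then obtain m where m: "n = p * m" "m \<in> ?A" by auto
    have "\<not> q dvd n" if "q \<in> P" for q
    proof -
      have "\<not> q dvd p" using primes_dvd_imp_eq[of q p] assms that by auto
      moreover have "\<not> q dvd m" using m that by auto
      ultimately show ?thesis using m assms(4)[OF that] by (simp add: prime_dvd_mult_iff)
    qed
    with m show "n \<in> {n \<in> ?A. p dvd n}" by auto
  qed
  have "infsum ?f ?A = infsum ?f (?B \<union> {n \<in> ?A. p dvd n})"
    by (rule arg_cong[of _ _ "infsum ?f"]) auto
  also have "\<dots> = infsum ?f ?B + infsum ?f {n \<in> ?A. p dvd n}"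
    by (intro infsum_Un_disjoint summable_on_powr assms) auto
  also have "infsum ?f {n \<in> ?A. p dvd n} = infsum (?f \<circ> (*) p) ?A"
    unfolding img using prime_gt_0_nat[OF assms(2)] by (intro infsum_reindex) (auto simp: inj_on_def)
  also have "?f \<circ> (*) p = (\<lambda>n. real p powr -s * ?f n)"
    by (auto simp: powr_mult)
  also have "infsum (\<lambda>n. real p powr -s * ?f n) ?A = real p powr -s * infsum ?f ?A"
    by (rule infsum_cmult_right) (intro summable_on_powr assms)
  finally show ?thesis by (simp add: algebra_simps)
qed

text \<open>The index 0 contributes \<open>0 powr -s = 0\<close>, so the series on the right is
  \<zeta>(s).\<close>

lemma infsum_sieve:
  assumes "s > 1" "finite P" "\<And>q. q \<in> P \<Longrightarrow> prime q"
  shows "infsum (\<lambda>n. real n powr -s) {n. \<forall>q\<in>P. \<not> q dvd n}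
       = (\<Prod>p\<in>P. 1 - real p powr -s) * (\<Sum>n. real n powr -s)"
  using assms(2,3)
proof (induction P rule: finite_induct)
  case empty
  have "infsum (\<lambda>n. real n powr -s) UNIV = (\<Sum>n. real n powr -s)"
    using assms(1) by (intro infsumI norm_summable_imp_has_sum)
      (auto simp: summable_real_powr_iff intro: summable_sums)
  then show ?case by simp
next
  case (insert p P)
  have "infsum (\<lambda>n. real n powr -s) {n. \<forall>q\<in>insert p P. \<not> q dvd n}
       = (1 - real p powr -s) * infsum (\<lambda>n. real n powr -s) {n. \<forall>q\<in>P. \<not> q dvd n}"
    using insert.hyps insert.prems by (intro infsum_sieve_step[OF assms(1)]) auto
  then show ?case using insert by simp
qed

text \<open>An integer above 1 without prime factors up to N exceeds N, so the sieve leaves only 1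
  and a part of the tail of the zeta series.\<close>

lemma infsum_coprime_to_primes_le:
  assumes "s > 1" "N \<ge> 2"
  shows "infsum (\<lambda>n. real n powr -s) {n. \<forall>q\<in>{p. prime p \<and> p \<le> N}. \<not> q dvd n} \<ge> 1"
    and "infsum (\<lambda>n. real n powr -s) {n. \<forall>q\<in>{p. prime p \<and> p \<le> N}. \<not> q dvd n}
           \<le> 1 + ((\<Sum>n. real n powr -s) - (\<Sum>n\<le>N. real n powr -s))"
proof -
  let ?f = "\<lambda>n. real n powr -s"
  let ?B = "{n. \<forall>q\<in>{p. prime p \<and> p \<le> N}. \<not> q dvd n}"
  have "1 \<in> ?B" using prime_gt_1_nat by auto
  then have "infsum ?f {1} \<le> infsum ?f ?B"
    by (intro infsum_mono_neutral summable_on_powr assms) auto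
  then show "infsum ?f ?B \<ge> 1" by simp
  have "?B \<subseteq> {1} \<union> {N<..}"
  proof
    fix n assume n: "n \<in> ?B"
    have "n > N" if neq: "n \<noteq> 1"
    proof -
      obtain p where p: "prime p" "p dvd n" using prime_factor_nat[OF neq] by blast
      then have "p > N" using n by auto
      \<comment> \<open>0 is a multiple of every prime; N \<ge> 2 puts 2 among the sieving primes
        and thereby excludes it.\<close>
      have "\<not> 2 dvd n" using n \<open>N \<ge> 2\<close> two_is_prime_nat by blast
      then have "n > 0" by (auto intro: Nat.gr0I)
      then have "p \<le> n" using p by (intro dvd_imp_le)
      with \<open>p > N\<close> show ?thesis by simp
    qed
    then show "n \<in> {1} \<union> {N<..}" by auto
  qed
  then have "infsum ?f ?B \<le> infsum ?f ({1} \<union> {N<..})"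
    by (intro infsum_mono_neutral summable_on_powr assms) auto
  also have "\<dots> = 1 + infsum ?f {N<..}"
    using assms by (subst infsum_Un_disjoint) (auto intro!: summable_on_powr)
  also have "infsum ?f {N<..} = infsum ?f UNIV - (\<Sum>n\<le>N. ?f n)"
  proof -
    have "infsum ?f UNIV = infsum ?f ({..N} \<union> {N<..})"
      by (rule arg_cong[of _ _ "infsum ?f"]) auto
    also have "\<dots> = (\<Sum>n\<le>N. ?f n) + infsum ?f {N<..}"
      using assms by (subst infsum_Un_disjoint) (auto intro!: summable_on_powr)
    finally show ?thesis by simp
  qed
  also have "infsum ?f UNIV = (\<Sum>n. ?f n)"
    using infsum_sieve[OF assms(1), of "{}"] by simp
  finally show "infsum ?f ?B \<le> 1 + ((\<Sum>n. ?f n) - (\<Sum>n\<le>N. ?f n))" by simp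
qed

lemma suminf_powr_pos:
  assumes "s > 1"
  shows "(\<Sum>n. real n powr -s) > 0"
  using assms by (intro suminf_pos2[of _ 1]) (auto simp: summable_real_powr_iff)

text \<open>Take logarithms in the sieve identity for the primes up to N. The sieved sum
  \<open>Z N\<close> tends to 1, so its logarithm disappears in the limit.\<close>

lemma euler_product_ln:
  assumes "s > 1"
  shows "(\<lambda>n. if prime n then - ln (1 - real n powr -s) else 0) sums ln (\<Sum>n. real n powr -s)"
proof -
  let ?f = "\<lambda>n. real n powr -s"
  let ?P = "\<lambda>N. {p. prime p \<and> p \<le> N}"
  define Z where "Z = (\<lambda>N. infsum ?f {n. \<forall>q\<in>?P N. \<not> q dvd n})"
  have summable: "summable ?f" using assms by (simp add: summable_real_powr_iff)
  have Z_lim: "Z \<longlonglongrightarrow> 1"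
  proof (rule tendsto_sandwich)
    show "\<forall>\<^sub>F N in sequentially. 1 \<le> Z N"
      using eventually_ge_at_top[of 2]
      by eventually_elim (simp only: Z_def infsum_coprime_to_primes_le(1)[OF assms])
    show "\<forall>\<^sub>F N in sequentially. Z N \<le> 1 + (suminf ?f - (\<Sum>n\<le>N. ?f n))"
      using eventually_ge_at_top[of 2]
      by eventually_elim (simp only: Z_def infsum_coprime_to_primes_le(2)[OF assms])
    have "(\<lambda>N. 1 + (suminf ?f - (\<Sum>n\<le>N. ?f n))) \<longlonglongrightarrow> 1 + (suminf ?f - suminf ?f)"
      by (intro tendsto_intros summable_LIMSEQ' summable)
    then show "(\<lambda>N. 1 + (suminf ?f - (\<Sum>n\<le>N. ?f n))) \<longlonglongrightarrow> 1" by simp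
  qed auto
  have factor_pos: "1 - ?f p > 0" if "prime p" for p
  proof -
    have "real p > 1" using prime_gt_1_nat[OF that] by simp
    then have "real p powr -s < real p powr 0" using assms by (intro powr_less_mono) auto
    then show ?thesis using \<open>real p > 1\<close> by simp
  qed
  have partial: "(\<Sum>n\<le>N. if prime n then - ln (1 - ?f n) else 0) = ln (suminf ?f) - ln (Z N)" for N
  proof -
    have "ln (Z N) = ln ((\<Prod>p\<in>?P N. 1 - ?f p) * suminf ?f)"
      unfolding Z_def by (subst infsum_sieve) (auto simp: assms)
    also have "\<dots> = ln (\<Prod>p\<in>?P N. 1 - ?f p) + ln (suminf ?f)"
      using suminf_powr_pos[OF assms] by (intro ln_mult_pos prod_pos factor_pos) auto
    also have "ln (\<Prod>p\<in>?P N. 1 - ?f p) = (\<Sum>p\<in>?P N. ln (1 - ?f p))"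
    proof (rule ln_prod)
      show "1 - ?f p \<noteq> 0" if "p \<in> ?P N" for p
        using factor_pos[of p] that by simp
    qed simp
    also have "\<dots> = - (\<Sum>n\<le>N. if prime n then - ln (1 - ?f n) else 0)"
      unfolding sum_negf [symmetric] by (intro sum.mono_neutral_cong_left) auto
    finally show ?thesis by simp
  qed
  have "(\<lambda>N. ln (suminf ?f) - ln (Z N)) \<longlonglongrightarrow> ln (suminf ?f) - ln 1"
    by (intro tendsto_intros Z_lim) auto
  then show ?thesis unfolding sums_def_le partial by simp
qed

section \<open>The zeta function near 1\<close>

lemma powr_diff_bounds:
  fixes n :: nat
  assumes "\<sigma> > 0" "n \<ge> 1"
  shows "\<sigma> * real (Suc n) powr -(1 + \<sigma>) \<le> real n powr -\<sigma> - real (Suc n) powr -\<sigma>"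
    and "real n powr -\<sigma> - real (Suc n) powr -\<sigma> \<le> \<sigma> * real n powr -(1 + \<sigma>)"
proof -
  have exponent: "-(1 + \<sigma>) = - \<sigma> - 1" by simp
  \<comment> \<open>Mean value theorem for x^-\<sigma> on [n, n + 1]; the derivative decreases in
    size, so its end values bound the difference.\<close>
  have "\<exists>z. z > real n \<and> z < real (Suc n) \<and>
      real (Suc n) powr -\<sigma> - real n powr -\<sigma> = (real (Suc n) - real n) * (- \<sigma> * z powr (- \<sigma> - 1))"
    using assms by (intro MVT2) (auto intro!: derivative_eq_intros)
  then obtain z where z: "z > real n" "z < real (Suc n)"
    and "real (Suc n) powr -\<sigma> - real n powr -\<sigma> = (real (Suc n) - real n) * (- \<sigma> * z powr (- \<sigma> - 1))"
    by blast
  then have eq: "real n powr -\<sigma> - real (Suc n) powr -\<sigma> = \<sigma> * z powr -(1 + \<sigma>)"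
    unfolding exponent by (simp add: algebra_simps)
  show "\<sigma> * real (Suc n) powr -(1 + \<sigma>) \<le> real n powr -\<sigma> - real (Suc n) powr -\<sigma>"
    unfolding eq using z assms by (intro mult_left_mono powr_mono2') auto
  show "real n powr -\<sigma> - real (Suc n) powr -\<sigma> \<le> \<sigma> * real n powr -(1 + \<sigma>)"
    unfolding eq using z assms by (intro mult_left_mono powr_mono2') auto
qed

text \<open>The integral test in telescoping form: the differences n^-\<sigma> - (n + 1)^-\<sigma>
  over n \<ge> 1 sum to 1 and lie between \<sigma> times the terms of the zeta series at n + 1 and
  at n.\<close>

lemma suminf_powr_bounds:
  assumes "\<sigma> > 0"
  shows "1 / \<sigma> \<le> (\<Sum>n. real n powr -(1 + \<sigma>))" "(\<Sum>n. real n powr -(1 + \<sigma>)) \<le> 1 + 1 / \<sigma>"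
proof -
  let ?f = "\<lambda>n. real n powr -(1 + \<sigma>)"
  define T where "T = (\<lambda>n. real (Suc n) powr -\<sigma>)"
  have "T \<longlonglongrightarrow> 0"
    unfolding T_def using assms by real_asymp
  then have T: "(\<lambda>n. T n - T (Suc n)) sums 1"
    using telescope_sums'[of T 0] by (simp add: T_def)
  have summable: "summable ?f" using assms by (simp add: summable_real_powr_iff)
  \<comment> \<open>Shifting past the index 0 removes the value 0, and the next shift removes the
    value 1.\<close>
  have s1: "(\<lambda>n. ?f (Suc n)) sums suminf ?f"
    using summable_sums[OF summable] by (subst sums_Suc_iff) auto
  have s2: "(\<lambda>n. ?f (Suc (Suc n))) sums (suminf ?f - 1)"
    using s1 sums_Suc_iff[of "\<lambda>n. ?f (Suc n)" "suminf ?f - 1"] by simp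
  have "1 \<le> \<sigma> * suminf ?f"
    by (rule sums_le[OF _ T sums_mult[OF s1]])
       (unfold T_def, rule powr_diff_bounds(2)[OF assms], simp)
  then show "1 / \<sigma> \<le> suminf ?f" using assms by (simp add: field_simps)
  have "\<sigma> * (suminf ?f - 1) \<le> 1"
    by (rule sums_le[OF _ sums_mult[OF s2] T])
       (unfold T_def, rule powr_diff_bounds(1)[OF assms], simp)
  then show "suminf ?f \<le> 1 + 1 / \<sigma>" using assms by (simp add: field_simps)
qed

section \<open>Abel's limit theorem and dyadic blocks\<close>

text \<open>Summation by parts expresses the error as -(1 - z) times a power series in the tails
  \<open>t\<close> of the original series. Finitely many tails are killed by the factor 1 - z; the
  small remaining ones contribute at most \<epsilon>/2, since (1 - z) cancels the geometric
  series.\<close>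

lemma abel_limit:
  fixes e :: "nat \<Rightarrow> real"
  assumes "summable e"
  shows "((\<lambda>z. \<Sum>k. e k * z ^ k) \<longlongrightarrow> suminf e) (at_left 1)"
proof -
  define S where "S = suminf e"
  define t where "t = (\<lambda>k. S - (\<Sum>i<k. e i))"
  have t_lim: "t \<longlonglongrightarrow> 0"
  proof -
    have "t \<longlonglongrightarrow> S - S" unfolding t_def S_def
      by (intro tendsto_intros summable_LIMSEQ assms)
    then show ?thesis by simp
  qed
  then have "Bseq t" by (intro convergent_imp_Bseq) (auto simp: convergent_def)
  then obtain B where B: "\<And>k. \<bar>t k\<bar> \<le> B" unfolding Bseq_def by auto
  have "B \<ge> 0" using B[of 0] by simp
  have t_powser: "summable (\<lambda>k. \<bar>t (k + j)\<bar> * z ^ k)" if "0 < z" "z < 1" for z :: real and j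
  proof (rule summable_comparison_test')
    show "summable (\<lambda>k. B * z ^ k)" using that by (intro summable_mult summable_geometric) auto
    show "norm (\<bar>t (k + j)\<bar> * z ^ k) \<le> B * z ^ k" if "k \<ge> 0" for k
      using B[of "k + j"] \<open>0 < z\<close> by (auto simp: abs_mult intro!: mult_right_mono)
  qed
  have t_powser': "summable (\<lambda>k. t (k + j) * z ^ k)" if "0 < z" "z < 1" for z :: real and j
    by (rule summable_rabs_cancel) (use t_powser[OF that, of j] that in \<open>simp add: abs_mult\<close>)
  have summation_by_parts: "(\<Sum>k. e k * z ^ k) - S = - (1 - z) * (\<Sum>k. t (k + 1) * z ^ k)"
    if z: "0 < z" "z < 1" for z
  proof -
    have "(\<Sum>k. e k * z ^ k) = (\<Sum>k. t k * z ^ k - t (k + 1) * z ^ k)"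
      by (simp add: t_def algebra_simps)
    also have "\<dots> = (\<Sum>k. t k * z ^ k) - (\<Sum>k. t (k + 1) * z ^ k)"
      using t_powser'[OF z, of 0] t_powser'[OF z, of 1] by (intro suminf_diff [symmetric]) auto
    also have "(\<Sum>k. t k * z ^ k) = t 0 + (\<Sum>k. t (Suc k) * z ^ Suc k)"
      using suminf_split_head[OF t_powser'[OF z, of 0]] by simp
    also have "(\<Sum>k. t (Suc k) * z ^ Suc k) = (\<Sum>k. z * (t (k + 1) * z ^ k))"
      by (simp add: algebra_simps)
    also have "\<dots> = z * (\<Sum>k. t (k + 1) * z ^ k)"
      by (rule suminf_mult) (rule t_powser'[OF z])
    finally show ?thesis by (simp add: t_def algebra_simps)
  qed
  show ?thesis
    unfolding S_def [symmetric]
  proof (rule tendstoI)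
    fix \<epsilon> :: real assume "\<epsilon> > 0"
    obtain N where N: "\<And>k. k \<ge> N \<Longrightarrow> \<bar>t k\<bar> < \<epsilon> / 2"
      using t_lim \<open>\<epsilon> > 0\<close> unfolding LIMSEQ_iff by (metis diff_zero half_gt_zero real_norm_def)
    have "((\<lambda>z::real. (1 - z) * (real N * B)) \<longlongrightarrow> (1 - 1) * (real N * B)) (at_left 1)"
      by (intro tendsto_intros)
    then have "\<forall>\<^sub>F z in at_left 1. (1 - z) * (real N * B) < \<epsilon> / 2"
      using \<open>\<epsilon> > 0\<close> by (intro order_tendstoD) auto
    moreover have "\<forall>\<^sub>F z :: real in at_left 1. 0 < z \<and> z < 1"
      by (intro eventually_at_leftI[of 0]) auto
    ultimately show "\<forall>\<^sub>F z in at_left 1. dist (\<Sum>k. e k * z ^ k) S < \<epsilon>"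
    proof eventually_elim
      case (elim z)
      \<comment> \<open>A majorant for the tail coefficients: \<open>B\<close> on the first
        \<open>N\<close> of them, plus \<epsilon>/2 on all.\<close>
      have geom: "(\<lambda>k. \<epsilon> / 2 * z ^ k) sums (\<epsilon> / 2 * (1 / (1 - z)))"
        using elim by (intro sums_mult geometric_sums) auto
      have head: "(\<lambda>k. if k < N then B else 0) sums (real N * B)"
        using sums_If_finite_set[of "{..<N}" "\<lambda>_. B"] by simp
      have "\<bar>\<Sum>k. t (k + 1) * z ^ k\<bar> \<le> (\<Sum>k. \<bar>t (k + 1) * z ^ k\<bar>)"
        by (rule summable_rabs) (use t_powser[of z 1] elim in \<open>simp add: abs_mult\<close>)
      also have "\<dots> \<le> real N * B + \<epsilon> / 2 * (1 / (1 - z))"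
      proof (rule sums_le[OF _ _ sums_add[OF head geom]])
        show "(\<lambda>k. \<bar>t (k + 1) * z ^ k\<bar>) sums (\<Sum>k. \<bar>t (k + 1) * z ^ k\<bar>)"
          by (rule summable_sums) (use t_powser[of z 1] elim in \<open>simp add: abs_mult\<close>)
        fix k
        have "\<bar>t (k + 1) * z ^ k\<bar> = \<bar>t (k + 1)\<bar> * z ^ k" using elim by (simp add: abs_mult)
        also have "\<dots> \<le> (if k < N then B else 0) + \<epsilon> / 2 * z ^ k"
        proof (cases "k < N")
          case True
          have "\<bar>t (k + 1)\<bar> * z ^ k \<le> B * 1"
            using B elim \<open>B \<ge> 0\<close> by (intro mult_mono power_le_one) auto
          moreover have "\<epsilon> / 2 * z ^ k \<ge> 0" using elim \<open>\<epsilon> > 0\<close> by simp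
          ultimately show ?thesis using True by simp
        next
          case False
          then have "\<bar>t (k + 1)\<bar> * z ^ k \<le> \<epsilon> / 2 * z ^ k"
            using N[of "k + 1"] elim by (intro mult_right_mono) auto
          then show ?thesis using False by simp
        qed
        finally show "\<bar>t (k + 1) * z ^ k\<bar> \<le> (if k < N then B else 0) + \<epsilon> / 2 * z ^ k" .
      qed
      finally have "(1 - z) * \<bar>\<Sum>k. t (k + 1) * z ^ k\<bar> \<le> (1 - z) * (real N * B + \<epsilon> / 2 * (1 / (1 - z)))"
        using elim by (intro mult_left_mono) auto
      also have "\<dots> = (1 - z) * (real N * B) + \<epsilon> / 2"
        using elim by (simp add: field_simps)
      also have "\<dots> < \<epsilon>" using elim by simp
      finally have "(1 - z) * \<bar>\<Sum>k. t (k + 1) * z ^ k\<bar> < \<epsilon>" .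
      then show ?case using elim summation_by_parts[of z] by (simp add: dist_real_def abs_mult)
    qed
  qed
qed

text \<open>Dirichlet's test for the weights 1/(k + 1): summation by parts leaves bounded factors
  times differences of the weights, and these telescope to 1.\<close>

lemma summable_div_Suc_of_bounded_sums:
  fixes x :: "nat \<Rightarrow> real"
  assumes "\<And>k. \<bar>\<Sum>i<k. x i\<bar> \<le> C"
  shows "summable (\<lambda>k. x k / real (Suc k))"
proof -
  define R where "R = (\<lambda>k. \<Sum>i<k. x i)"
  have R: "\<bar>R k\<bar> \<le> C" for k using assms by (simp add: R_def)
  have parts: "(\<Sum>k<K. x k / real (Suc k))
      = R K / real (Suc K) + (\<Sum>k<K. R (Suc k) * (1 / real (Suc k) - 1 / real (Suc (Suc k))))" for K
  proof (induction K)
    case (Suc K)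
    have "x K = R (Suc K) - R K" by (simp add: R_def)
    then show ?case unfolding sum.lessThan_Suc Suc
      by (simp add: diff_divide_distrib right_diff_distrib)
  qed (simp add: R_def)
  have "(\<lambda>K. R K / real (Suc K)) \<longlonglongrightarrow> 0"
  proof (rule Lim_null_comparison)
    show "\<forall>\<^sub>F K in sequentially. norm (R K / real (Suc K)) \<le> C / real (Suc K)"
      using R by (intro always_eventually) (auto intro!: divide_right_mono)
    show "(\<lambda>K. C / real (Suc K)) \<longlonglongrightarrow> 0" by real_asymp
  qed
  moreover have "summable (\<lambda>k. R (Suc k) * (1 / real (Suc k) - 1 / real (Suc (Suc k))))"
  proof (rule summable_comparison_test')
    have "(\<lambda>k. C * (1 / real (Suc k) - 1 / real (Suc (Suc k)))) sums (C * (1 - 0))"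
      using telescope_sums'[of "\<lambda>k. 1 / real (Suc k)" 0] LIMSEQ_inverse_real_of_nat
      by (intro sums_mult) (simp add: field_simps)
    then show "summable (\<lambda>k. C * (1 / real (Suc k) - 1 / real (Suc (Suc k))))"
      by (rule sums_summable)
    show "norm (R (Suc k) * (1 / real (Suc k) - 1 / real (Suc (Suc k))))
        \<le> C * (1 / real (Suc k) - 1 / real (Suc (Suc k)))" if "k \<ge> 0" for k
    proof -
      have nonneg: "0 \<le> 1 / real (Suc k) - 1 / real (Suc (Suc k))" by (simp add: frac_le)
      show ?thesis unfolding real_norm_def abs_mult abs_of_nonneg[OF nonneg]
        by (intro mult_right_mono R nonneg)
    qed
  qed
  ultimately have "convergent (\<lambda>K. R K / real (Suc K) +
      (\<Sum>k<K. R (Suc k) * (1 / real (Suc k) - 1 / real (Suc (Suc k)))))"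
    unfolding summable_iff_convergent by (rule convergent_add[OF convergentI])
  then show ?thesis unfolding summable_iff_convergent parts .
qed

section \<open>Dyadic blocks of primes\<close>

lemma sum_dyadic_blocks:
  fixes f :: "nat \<Rightarrow> 'a :: comm_monoid_add"
  assumes "f 0 = 0" "f 1 = 0"
  shows "(\<Sum>k<K. \<Sum>n\<in>{2^k<..2^Suc k}. f n) = (\<Sum>n\<le>2^K. f n)"
proof (induction K)
  case 0
  \<comment> \<open>The blocks cover only the indices from 2 on, so the values at 0 and 1 have to
    vanish.\<close>
  have "{..1::nat} = {0, 1}" by auto
  then show ?case using assms by simp
next
  case (Suc K)
  have "{..2^Suc K} = {..2^K} \<union> {2^K<..2^Suc K::nat}" by auto
  moreover have "{..2^K} \<inter> {2^K<..2^Suc K::nat} = {}" by auto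
  ultimately have "(\<Sum>n\<le>2^Suc K. f n) = (\<Sum>n\<le>2^K. f n) + (\<Sum>n\<in>{2^K<..2^Suc K}. f n)"
    by (simp only: sum.union_disjoint finite_atMost finite_greaterThanAtMost)
  then show ?case using Suc by (simp only: sum.lessThan_Suc)
qed

lemma euler_log_0_1 [simp]: "euler_log 0 = 0" "euler_log (Suc 0) = 0"
  by (auto simp: euler_log_def)

text \<open>This is \<open>d\<^sub>k\<close> of the introductory outline.\<close>

definition dyadic_log :: "nat \<Rightarrow> real" where
  "dyadic_log k = (\<Sum>n\<in>{2^k<..2^Suc k}. euler_log n)"

lemma ln_dyadic_bounds:
  assumes "n \<in> {2^k<..2^Suc k}"
  shows "real k * ln 2 \<le> ln (real n)" "ln (real n) \<le> real (Suc k) * ln 2"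
proof -
  have n: "(2::real)^k < real n" "real n \<le> 2^Suc k"
    using assms of_nat_less_iff[where ?'a = real, of "2^k" n] of_nat_le_iff[where ?'a = real, of n "2^Suc k"]
    by simp_all
  have "real n > 0" using assms by auto
  have "ln ((2::real)^k) \<le> ln (real n)" using n by (intro ln_mono) auto
  then show "real k * ln 2 \<le> ln (real n)" by (simp add: ln_realpow)
  have "ln (real n) \<le> ln ((2::real)^Suc k)" using n \<open>real n > 0\<close> by (intro ln_mono) auto
  then show "ln (real n) \<le> real (Suc k) * ln 2" by (simp only: ln_realpow zero_less_numeral)
qed

text \<open>On block k the ratio ln n / ln 2 lies between k and k + 1. So
  \<open>dyadic_log k\<close> equals \<open>l k / (k + 1)\<close> up to O(1/k^2), where
  \<open>l k\<close> is the block sum weighted by this ratio, and Mertens' first theorem bounds the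
  partial sums of \<open>l k - 1\<close>.\<close>

lemma summable_dyadic_log_diff: "summable (\<lambda>k. dyadic_log k - 1 / real (Suc k))"
proof -
  define l where "l = (\<lambda>k. (\<Sum>n\<in>{2^k<..2^Suc k}. euler_log n * ln (real n)) / ln 2)"
  obtain C where C: "\<And>N. N \<ge> 1 \<Longrightarrow> \<bar>(\<Sum>n\<le>N. euler_log n * ln (real n)) - ln (real N)\<bar> \<le> C"
    by (rule mertens_first) blast
  have bounded: "\<bar>\<Sum>i<k. l i - 1\<bar> \<le> C / ln 2" for k
  proof -
    have "(\<Sum>i<k. l i) = (\<Sum>n\<le>2^k. euler_log n * ln (real n)) / ln 2"
      unfolding l_def sum_divide_distrib [symmetric] by (subst sum_dyadic_blocks) auto
    then have "(\<Sum>i<k. l i - 1) = ((\<Sum>n\<le>2^k. euler_log n * ln (real n)) - ln (real (2^k))) / ln 2"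
      by (simp add: sum_subtractf ln_realpow diff_divide_distrib)
    then show ?thesis using C[of "2^k"] by (simp add: divide_right_mono)
  qed
  \<comment> \<open>\<open>l k - 1\<close> is a difference of two partial sums, each at most
    \<open>C / ln 2\<close> in absolute value.\<close>
  have l_le: "l k \<le> 1 + 2 * (C / ln 2)" for k
    using bounded[of k] bounded[of "Suc k"] by simp
  \<comment> \<open>With d for \<open>dyadic_log k\<close> and l for \<open>l k\<close>, both follow
    from k d \<le> l \<le> (k + 1) d, because l - k l / (k + 1) = l / (k + 1).\<close>
  have main: "0 \<le> dyadic_log k - l k / real (Suc k)"
      "real k * (dyadic_log k - l k / real (Suc k)) \<le> l k / real (Suc k)" for k
  proof -
    have "l k \<le> (\<Sum>n\<in>{2^k<..2^Suc k}. euler_log n * (real (Suc k) * ln 2)) / ln 2"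
      unfolding l_def using ln_dyadic_bounds(2)
      by (intro divide_right_mono sum_mono mult_left_mono euler_log_nonneg) auto
    also have "\<dots> = real (Suc k) * dyadic_log k"
      unfolding dyadic_log_def by (simp add: sum_distrib_right [symmetric])
    finally show "0 \<le> dyadic_log k - l k / real (Suc k)" by (simp add: field_simps)
    have "real k * dyadic_log k = (\<Sum>n\<in>{2^k<..2^Suc k}. euler_log n * (real k * ln 2)) / ln 2"
      unfolding dyadic_log_def by (simp add: sum_distrib_right [symmetric])
    also have "\<dots> \<le> l k"
      unfolding l_def using ln_dyadic_bounds(1)
      by (intro divide_right_mono sum_mono mult_left_mono euler_log_nonneg) auto
    finally have "real k * dyadic_log k - real k * (l k / real (Suc k)) \<le> l k - real k * (l k / real (Suc k))"
      by simp
    also have "\<dots> = l k / real (Suc k)" by (simp add: field_simps)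
    finally show "real k * (dyadic_log k - l k / real (Suc k)) \<le> l k / real (Suc k)"
      by (simp only: right_diff_distrib)
  qed
  have "summable (\<lambda>k. dyadic_log k - l k / real (Suc k))"
  proof (rule summable_comparison_test')
    have "summable (\<lambda>k. 1 / (real k * real (Suc k)))"
    proof (rule summable_comparison_test_bigo)
      show "summable (\<lambda>n. norm (real n powr -2))" by (simp add: summable_real_powr_iff)
      show "(\<lambda>k. 1 / (real k * real (Suc k))) \<in> O(\<lambda>n. real n powr -2)" by real_asymp
    qed
    then show "summable (\<lambda>k. (1 + 2 * (C / ln 2)) * (1 / (real k * real (Suc k))))"
      by (rule summable_mult)
    fix k :: nat assume "k \<ge> 1"
    have "real k * (dyadic_log k - l k / real (Suc k)) \<le> (1 + 2 * (C / ln 2)) / real (Suc k)"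
      using main(2)[of k] by (rule order.trans) (intro divide_right_mono l_le, simp)
    then have "dyadic_log k - l k / real (Suc k) \<le> (1 + 2 * (C / ln 2)) / real (Suc k) / real k"
      using \<open>k \<ge> 1\<close> by (subst pos_le_divide_eq) (auto simp: mult.commute)
    then show "norm (dyadic_log k - l k / real (Suc k)) \<le> (1 + 2 * (C / ln 2)) * (1 / (real k * real (Suc k)))"
      using main(1)[of k] by (simp add: mult.commute)
  qed
  \<comment> \<open>Adding the summable terms \<open>(l k - 1) / (k + 1)\<close> cancels
    \<open>l k\<close> and leaves -1/(k + 1).\<close>
  from summable_add[OF this summable_div_Suc_of_bounded_sums[OF bounded]]
  show ?thesis by (simp add: diff_divide_distrib)
qed

section \<open>Mertens' third theorem\<close>

text \<open>With p^-\<sigma> inside the logarithm, as in - ln (1 - p^-(1 + \<sigma>)), this would be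
  ln \<zeta>(1 + \<sigma>). Outside it the coefficients do not depend on \<sigma>, as the comparison
  with a power series demands.\<close>

definition euler_log_series :: "real \<Rightarrow> real" where
  "euler_log_series \<sigma> = (\<Sum>n. euler_log n * real n powr -\<sigma>)"

text \<open>The remainder is at most t^2 / (1 - t), which increases in t. Its value at t = 1/n gives
  a summable majorant that is uniform in \<sigma>.\<close>

lemma log_remainder_bounds:
  fixes n :: nat and t :: real
  assumes "prime n" "0 \<le> t" "t \<le> 1 / real n"
  shows "0 \<le> - ln (1 - t) - t" "- ln (1 - t) - t \<le> 1 / (real n * (real n - 1))"
proof -
  have n: "real n > 1" using prime_gt_1_nat[OF assms(1)] by simp
  then have "1 / real n < 1" by simp
  with assms have t: "t < 1" by linarith
  show "0 \<le> - ln (1 - t) - t" using minus_ln_one_minus_bounds[of t] assms t by simp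
  have "- ln (1 - t) - t \<le> t / (1 - t) - t" using minus_ln_one_minus_bounds[of t] assms t by simp
  also have "\<dots> = t * t / (1 - t)" using t by (simp add: field_simps)
  also have "\<dots> \<le> (1 / real n * (1 / real n)) / (1 - 1 / real n)"
    using assms t n by (intro frac_le mult_mono) auto
  also have "\<dots> = 1 / (real n * (real n - 1))" using n by (simp add: field_simps)
  finally show "- ln (1 - t) - t \<le> 1 / (real n * (real n - 1))" .
qed

text \<open>Compare term by term with the Euler product. The difference \<open>D n \<sigma>\<close>
  is dominated by \<open>M n\<close> for every \<sigma> > 0 and tends to 0 for fixed n, so Tannery's
  theorem sends the sum to 0.\<close>

lemma euler_log_series_asymp:
  shows summable_euler_log_series: "\<And>\<sigma>. \<sigma> > 0 \<Longrightarrow> summable (\<lambda>n. euler_log n * real n powr -\<sigma>)"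
    and euler_log_series_zeta:
      "((\<lambda>\<sigma>. euler_log_series \<sigma> - ln (\<Sum>n. real n powr -(1 + \<sigma>))) \<longlongrightarrow> 0) (at_right 0)"
proof -
  define g where "g = (\<lambda>\<sigma> n. if prime n then - ln (1 - real n powr -(1 + \<sigma>)) else 0)"
  define D where "D = (\<lambda>n \<sigma>. euler_log n * real n powr -\<sigma> - g \<sigma> n)"
  define M where "M = (\<lambda>n. 1 / (real n * (real n - 1)))"
  have M_summable: "summable M"
  proof (rule summable_comparison_test_bigo)
    show "summable (\<lambda>n. norm (real n powr -2))" by (simp add: summable_real_powr_iff)
    show "M \<in> O(\<lambda>n. real n powr -2)" unfolding M_def by real_asymp
  qed
  have D_le: "norm (D n \<sigma>) \<le> M n" if "\<sigma> > 0" for n \<sigma>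
  proof (cases "prime n")
    case False
    then show ?thesis by (cases "n = 0") (auto simp: D_def g_def M_def euler_log_def)
  next
    case True
    then have n: "real n > 1" using prime_gt_1_nat by auto
    define t where "t = real n powr -(1 + \<sigma>)"
    have powr_le: "real n powr -\<sigma> \<le> 1" using powr_mono[of "-\<sigma>" 0 "real n"] n that by simp
    have t: "t = 1 / real n * real n powr -\<sigma>"
      using n by (simp add: t_def powr_add [symmetric] powr_minus_divide powr_diff)
    then have "t \<le> 1 / real n" "t \<ge> 0" using mult_left_mono[OF powr_le, of "1 / real n"] by auto
    note t_bounds = log_remainder_bounds[OF True this(2,1)]
    note n_bounds = log_remainder_bounds[OF True, of "1 / real n", simplified]
    \<comment> \<open>The linear parts of both logarithms equal \<open>t\<close> and cancel, leaving
      a difference of two quadratic remainders in [0, \<open>M n\<close>].\<close>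
    have "D n \<sigma> = (- ln (1 - 1 / real n) - 1 / real n) * real n powr -\<sigma> - (- ln (1 - t) - t)"
    proof -
      have "D n \<sigma> = - ln (1 - 1 / real n) * real n powr -\<sigma> + ln (1 - t)"
        using True by (simp add: D_def g_def euler_log_def t_def)
      also have "\<dots> = - ln (1 - 1 / real n) * real n powr -\<sigma> - 1 / real n * real n powr -\<sigma> + t + ln (1 - t)"
        using t by linarith
      finally show ?thesis by (simp add: left_diff_distrib)
    qed
    moreover have "0 \<le> (- ln (1 - 1 / real n) - 1 / real n) * real n powr -\<sigma>"
      using n_bounds(1) by (intro mult_nonneg_nonneg) auto
    moreover have "(- ln (1 - 1 / real n) - 1 / real n) * real n powr -\<sigma> \<le> M n * 1"
      unfolding M_def using n_bounds powr_le n by (intro mult_mono) auto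
    ultimately show ?thesis using t_bounds unfolding M_def by (simp add: abs_le_iff)
  qed
  have D_summable: "summable (\<lambda>n. D n \<sigma>)" if "\<sigma> > 0" for \<sigma>
    using D_le[OF that] by (intro summable_comparison_test'[OF M_summable]) auto
  have g_sums: "g \<sigma> sums ln (\<Sum>n. real n powr -(1 + \<sigma>))" if "\<sigma> > 0" for \<sigma>
    using euler_product_ln[of "1 + \<sigma>"] that by (simp add: g_def)
  have series: "(\<lambda>n. euler_log n * real n powr -\<sigma>) sums
      ((\<Sum>n. D n \<sigma>) + ln (\<Sum>n. real n powr -(1 + \<sigma>)))" if "\<sigma> > 0" for \<sigma>
    using sums_add[OF summable_sums[OF D_summable[OF that]] g_sums[OF that]]
    by (simp add: D_def)
  then show "summable (\<lambda>n. euler_log n * real n powr -\<sigma>)" if "\<sigma> > 0" for \<sigma>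
    using that sums_summable by blast
  have pos: "\<forall>\<^sub>F \<sigma> :: real in at_right 0. \<sigma> > 0" by (simp add: eventually_at_right_less)
  have "((\<lambda>\<sigma>. \<Sum>n. D n \<sigma>) \<longlongrightarrow> (\<Sum>n::nat. 0)) (at_right 0)"
  proof (intro conjunct2[OF conjunct2[OF tannerys_theorem[OF _ _ M_summable]]])
    fix n
    show "((\<lambda>\<sigma>. D n \<sigma>) \<longlongrightarrow> 0) (at_right 0)"
    proof (cases "prime n")
      case True
      then have n: "real n > 1" using prime_gt_1_nat by auto
      have p0: "((\<lambda>\<sigma>. real n powr -\<sigma>) \<longlongrightarrow> real n powr -0) (at_right 0)"
        using n by (intro tendsto_intros) auto
      have p1: "((\<lambda>\<sigma>. real n powr -(1 + \<sigma>)) \<longlongrightarrow> real n powr -(1 + 0)) (at_right 0)"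
        using n by (intro tendsto_intros) auto
      have "((\<lambda>\<sigma>. D n \<sigma>) \<longlongrightarrow> euler_log n * real n powr -0 - - ln (1 - real n powr -(1 + 0))) (at_right 0)"
        using True n unfolding D_def g_def
        by (simp only: if_True, intro tendsto_intros p0 p1) (auto simp: powr_minus_divide)
      then show ?thesis using True n by (simp add: euler_log_def powr_minus_divide)
    qed (simp add: D_def g_def euler_log_def)
  next
    show "\<forall>\<^sub>F (k, \<sigma>) in sequentially \<times>\<^sub>F at_right 0. norm (D k \<sigma>) \<le> M k"
      unfolding eventually_prod_filter
      by (intro exI[of _ "\<lambda>_. True"] exI[of _ "\<lambda>\<sigma>. \<sigma> > 0"]) (use pos D_le in auto)
  qed auto
  moreover have "\<forall>\<^sub>F \<sigma> in at_right 0. (\<Sum>n. D n \<sigma>) = euler_log_series \<sigma> - ln (\<Sum>n. real n powr -(1 + \<sigma>))"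
    using pos by eventually_elim (use series sums_unique in \<open>fastforce simp: euler_log_series_def\<close>)
  ultimately show "((\<lambda>\<sigma>. euler_log_series \<sigma> - ln (\<Sum>n. real n powr -(1 + \<sigma>))) \<longlongrightarrow> 0) (at_right 0)"
    by (subst (asm) tendsto_cong) auto
qed

lemma ln_suminf_powr_asymp: "((\<lambda>\<sigma>. ln (\<Sum>n. real n powr -(1 + \<sigma>)) + ln \<sigma>) \<longlongrightarrow> 0) (at_right 0)"
proof (rule tendsto_sandwich)
  have pos: "\<forall>\<^sub>F \<sigma> :: real in at_right 0. \<sigma> > 0" by (simp add: eventually_at_right_less)
  show "\<forall>\<^sub>F \<sigma> in at_right 0. 0 \<le> ln (\<Sum>n. real n powr -(1 + \<sigma>)) + ln \<sigma>"
    using pos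
  proof eventually_elim
    case (elim \<sigma>)
    have "ln (1 / \<sigma>) \<le> ln (\<Sum>n. real n powr -(1 + \<sigma>))"
      using suminf_powr_bounds(1)[OF elim] elim by (intro ln_mono) auto
    then show ?case using elim by (simp add: ln_div)
  qed
  show "\<forall>\<^sub>F \<sigma> in at_right 0. ln (\<Sum>n. real n powr -(1 + \<sigma>)) + ln \<sigma> \<le> ln (1 + 1 / \<sigma>) + ln \<sigma>"
    using pos
  proof eventually_elim
    case (elim \<sigma>)
    then show ?case
      using suminf_powr_bounds(2)[OF elim] suminf_powr_pos[of "1 + \<sigma>"] by simp
  qed
  show "((\<lambda>\<sigma>::real. ln (1 + 1 / \<sigma>) + ln \<sigma>) \<longlongrightarrow> 0) (at_right 0)" by real_asymp
qed auto

lemma euler_log_series_ln: "((\<lambda>\<sigma>. euler_log_series \<sigma> + ln \<sigma>) \<longlongrightarrow> 0) (at_right 0)"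
  using tendsto_add[OF euler_log_series_zeta ln_suminf_powr_asymp] by simp

section \<open>The Dirichlet series against the dyadic power series\<close>

lemma dyadic_log_series_bounds:
  assumes "\<sigma> > 0"
  defines "z \<equiv> 2 powr -\<sigma>"
  shows "summable (\<lambda>k. dyadic_log k * z ^ Suc k)"
    and "(\<Sum>k. dyadic_log k * z ^ Suc k) \<le> euler_log_series \<sigma>"
    and "z * euler_log_series \<sigma> \<le> (\<Sum>k. dyadic_log k * z ^ Suc k)"
proof -
  have z_pos: "z > 0" by (simp add: z_def)
  have z_power: "z ^ k = (2 ^ k) powr -\<sigma>" for k
    by (simp add: z_def powr_powr powr_realpow [symmetric] mult.commute)
  define b where "b = (\<lambda>k. \<Sum>n\<in>{2^k<..2^Suc k}. euler_log n * real n powr -\<sigma>)"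
  have b_sums: "b sums euler_log_series \<sigma>"
  proof -
    have "(\<lambda>N. \<Sum>n\<le>N. euler_log n * real n powr -\<sigma>) \<longlonglongrightarrow> euler_log_series \<sigma>"
      unfolding euler_log_series_def by (intro summable_LIMSEQ' summable_euler_log_series assms)
    moreover have "filterlim (\<lambda>K. 2 ^ K :: nat) at_top sequentially"
      by real_asymp
    ultimately have "(\<lambda>K. \<Sum>n\<le>2^K. euler_log n * real n powr -\<sigma>) \<longlonglongrightarrow> euler_log_series \<sigma>"
      by (rule filterlim_compose)
    then show ?thesis
      unfolding sums_def b_def by (subst sum_dyadic_blocks) auto
  qed
  \<comment> \<open>n^-\<sigma> decreases, so on the block it lies between its values at the end
    points, z^(k+1) and z^k.\<close>
  have n_bounds: "z ^ Suc k \<le> real n powr -\<sigma>" "real n powr -\<sigma> \<le> z ^ k"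
    if "n \<in> {2^k<..2^Suc k}" for n k
  proof -
    have n: "(2::real)^k < real n" "real n \<le> 2^Suc k"
      using that of_nat_less_iff[where ?'a = real, of "2^k" n] of_nat_le_iff[where ?'a = real, of n "2^Suc k"]
      by simp_all
    moreover have "real n > 0" using that by auto
    ultimately show "z ^ Suc k \<le> real n powr -\<sigma>" "real n powr -\<sigma> \<le> z ^ k"
      unfolding z_power using assms by (intro powr_mono2'; simp)+
  qed
  have lower: "dyadic_log k * z ^ Suc k \<le> b k" and upper: "b k \<le> dyadic_log k * z ^ k" for k
    unfolding dyadic_log_def b_def sum_distrib_right
    by (intro sum_mono mult_left_mono n_bounds euler_log_nonneg; assumption)+
  have nonneg: "dyadic_log k * z ^ Suc k \<ge> 0" for k
    using z_pos by (simp add: dyadic_log_def sum_nonneg euler_log_nonneg)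
  show summable: "summable (\<lambda>k. dyadic_log k * z ^ Suc k)"
    using lower nonneg by (intro summable_comparison_test'[OF sums_summable[OF b_sums]]) auto
  show "(\<Sum>k. dyadic_log k * z ^ Suc k) \<le> euler_log_series \<sigma>"
    by (rule sums_le[OF lower summable_sums[OF summable] b_sums])
  show "z * euler_log_series \<sigma> \<le> (\<Sum>k. dyadic_log k * z ^ Suc k)"
  proof (rule sums_le[OF _ sums_mult[OF b_sums] summable_sums[OF summable]])
    show "z * b k \<le> dyadic_log k * z ^ Suc k" for k
      using mult_left_mono[OF upper[of k], of z] z_pos by (simp add: mult_ac)
  qed
qed

lemma harmonic_powser_sums:
  fixes z :: real
  assumes "0 < z" "z < 1"
  shows "(\<lambda>k. z ^ Suc k / real (Suc k)) sums - ln (1 - z)"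
proof -
  have "ln (1 - z) = (\<Sum>n. (-1)^n * (1 / real (n + 1)) * ((1 - z) - 1)^(Suc n))"
    using assms by (intro ln_series) auto
  also have "\<dots> = (\<Sum>n. - (z ^ Suc n / real (Suc n)))"
  proof (intro suminf_cong)
    fix n
    have "(-1)^n * (- z) ^ Suc n = - (((-1) * (- z)) ^ n * z)"
      unfolding power_mult_distrib by simp
    then show "(-1)^n * (1 / real (n + 1)) * ((1 - z) - 1)^(Suc n) = - (z ^ Suc n / real (Suc n))"
      by (simp add: field_simps)
  qed
  finally have ln: "ln (1 - z) = (\<Sum>n. - (z ^ Suc n / real (Suc n)))" .
  have "summable (\<lambda>n. - (z ^ Suc n / real (Suc n)))"
  proof (rule summable_comparison_test')
    show "summable (\<lambda>n. z ^ n)" using assms by (intro summable_geometric) auto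
    show "norm (- (z ^ Suc n / real (Suc n))) \<le> z ^ n" if "n \<ge> 0" for n
    proof -
      have "z ^ Suc n / real (Suc n) \<le> z ^ Suc n / 1" using assms by (intro divide_left_mono) auto
      also have "\<dots> \<le> z ^ n" using assms by (simp add: mult_left_le_one_le)
      finally show ?thesis using assms by simp
    qed
  qed
  from sums_minus[OF summable_sums[OF this]] show ?thesis unfolding ln [symmetric] by simp
qed

text \<open>Evaluate the limit of \<open>Q \<sigma> + ln (1 - 2 powr -\<sigma>)\<close> at 0 twice:
  Abel's theorem yields the sum, and the logarithmic singularity of ln \<zeta> yields the
  number.\<close>

lemma suminf_dyadic_log_diff: "(\<Sum>k. dyadic_log k - 1 / real (Suc k)) = ln (ln 2)"
proof -
  let ?e = "\<lambda>k. dyadic_log k - 1 / real (Suc k)"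
  let ?E = euler_log_series
  define Q where "Q = (\<lambda>\<sigma>. \<Sum>k. dyadic_log k * (2 powr -\<sigma>) ^ Suc k)"
  have pos: "\<forall>\<^sub>F \<sigma> :: real in at_right 0. \<sigma> > 0" by (simp add: eventually_at_right_less)
  \<comment> \<open>The extra factor z = 2^-\<sigma> shifts the exponent k of Abel's theorem to the
    k + 1 of \<open>Q\<close> and of the logarithmic series; it tends to 1.\<close>
  have "((\<lambda>\<sigma>. 2 powr -\<sigma> * (\<Sum>k. ?e k * (2 powr -\<sigma>) ^ k)) \<longlongrightarrow> 1 * suminf ?e) (at_right 0)"
  proof (rule tendsto_mult)
    show "((\<lambda>\<sigma>::real. 2 powr -\<sigma>) \<longlongrightarrow> 1) (at_right 0)" by real_asymp
    have "filterlim (\<lambda>\<sigma>::real. 2 powr -\<sigma>) (at_left 1) (at_right 0)" by real_asymp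
    then show "((\<lambda>\<sigma>. \<Sum>k. ?e k * (2 powr -\<sigma>) ^ k) \<longlongrightarrow> suminf ?e) (at_right 0)"
      by (rule filterlim_compose[OF abel_limit[OF summable_dyadic_log_diff]])
  qed
  moreover have "\<forall>\<^sub>F \<sigma> in at_right 0. 2 powr -\<sigma> * (\<Sum>k. ?e k * (2 powr -\<sigma>) ^ k) = Q \<sigma> + ln (1 - 2 powr -\<sigma>)"
    using pos
  proof eventually_elim
    case (elim \<sigma>)
    define z where "z = 2 powr -\<sigma>"
    have "2 powr -\<sigma> < 2 powr (0::real)" using elim by (intro powr_less_mono) auto
    then have z: "0 < z" "z < 1" by (auto simp: z_def)
    have "(\<lambda>k. dyadic_log k * z ^ Suc k - z ^ Suc k / real (Suc k)) sums (Q \<sigma> - - ln (1 - z))"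
      using dyadic_log_series_bounds(1)[OF elim] unfolding Q_def z_def [symmetric]
      by (intro sums_diff summable_sums harmonic_powser_sums z)
    then have "(\<lambda>k. z * (?e k * z ^ k)) sums (Q \<sigma> + ln (1 - z))"
      by (simp add: algebra_simps)
    then have "(\<lambda>k. inverse z * (z * (?e k * z ^ k))) sums (inverse z * (Q \<sigma> + ln (1 - z)))"
      by (rule sums_mult)
    then have "(\<lambda>k. ?e k * z ^ k) sums (inverse z * (Q \<sigma> + ln (1 - z)))"
      using z by (simp only: mult.assoc [symmetric]) simp
    then have "z * (\<Sum>k. ?e k * z ^ k) = z * (inverse z * (Q \<sigma> + ln (1 - z)))"
      by (simp only: sums_unique [symmetric])
    then show ?case using z by (simp add: z_def)
  qed
  ultimately have abel: "((\<lambda>\<sigma>. Q \<sigma> + ln (1 - 2 powr -\<sigma>)) \<longlongrightarrow> suminf ?e) (at_right 0)"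
    by (subst (asm) tendsto_cong) auto
  have E: "((\<lambda>\<sigma>. ?E \<sigma> + ln \<sigma>) \<longlongrightarrow> 0) (at_right 0)" by (rule euler_log_series_ln)
  \<comment> \<open>The block bounds give 0 \<le> E - Q \<le> (1 - z) E. Here E grows only like - ln
    \<sigma> while 1 - z is of order \<sigma>; splitting E into (E + ln \<sigma>) - ln \<sigma>
    reduces this to known limits.\<close>
  have gap: "((\<lambda>\<sigma>. ?E \<sigma> - Q \<sigma>) \<longlongrightarrow> 0) (at_right 0)"
  proof (rule tendsto_sandwich)
    show "\<forall>\<^sub>F \<sigma> in at_right 0. 0 \<le> ?E \<sigma> - Q \<sigma>"
      using pos by eventually_elim (use dyadic_log_series_bounds(2) in \<open>simp add: Q_def\<close>)
    show "\<forall>\<^sub>F \<sigma> in at_right 0. ?E \<sigma> - Q \<sigma> \<le> (1 - 2 powr -\<sigma>) * (?E \<sigma> + ln \<sigma>) - (1 - 2 powr -\<sigma>) * ln \<sigma>"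
      using pos by eventually_elim (use dyadic_log_series_bounds(3) in \<open>simp add: Q_def algebra_simps\<close>)
    have "((\<lambda>\<sigma>::real. 1 - 2 powr -\<sigma>) \<longlongrightarrow> 0) (at_right 0)"
      "((\<lambda>\<sigma>::real. (1 - 2 powr -\<sigma>) * ln \<sigma>) \<longlongrightarrow> 0) (at_right 0)" by real_asymp+
    from tendsto_diff[OF tendsto_mult[OF this(1) E] this(2)]
    show "((\<lambda>\<sigma>. (1 - 2 powr -\<sigma>) * (?E \<sigma> + ln \<sigma>) - (1 - 2 powr -\<sigma>) * ln \<sigma>) \<longlongrightarrow> 0) (at_right 0)"
      by simp
  qed auto
  \<comment> \<open>(1 - 2^-\<sigma>) / \<sigma> tends to ln 2.\<close>
  have "((\<lambda>\<sigma>::real. - ln \<sigma> + ln (1 - 2 powr -\<sigma>)) \<longlongrightarrow> ln (ln 2)) (at_right 0)" by real_asymp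
  from tendsto_add[OF tendsto_diff[OF E gap] this]
  have "((\<lambda>\<sigma>. Q \<sigma> + ln (1 - 2 powr -\<sigma>)) \<longlongrightarrow> ln (ln 2)) (at_right 0)" by simp
  from tendsto_unique[OF _ abel this] show ?thesis by simp
qed

text \<open>Summing \<open>dyadic_log k - 1/(k + 1)\<close> over k < K subtracts the harmonic number
  \<open>harm K\<close>, whose excess over ln K tends to \<gamma>.\<close>

lemma mertens_dyadic:
  "(\<lambda>K. (\<Sum>n\<le>2^K. euler_log n) - ln (real K)) \<longlonglongrightarrow> euler_mascheroni + ln (ln 2)"
proof -
  have harm: "(\<Sum>k<K. 1 / real (Suc k)) = harm K" for K
    by (induction K) (auto simp: harm_Suc harm_def[of 0] field_simps)
  have "(\<lambda>K. (\<Sum>k<K. dyadic_log k - 1 / real (Suc k)) + (harm K - ln (real K)))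
      \<longlonglongrightarrow> ln (ln 2) + euler_mascheroni"
    using summable_LIMSEQ[OF summable_dyadic_log_diff] unfolding suminf_dyadic_log_diff
    by (intro tendsto_add euler_mascheroni_LIMSEQ)
  moreover have "(\<Sum>k<K. dyadic_log k) = (\<Sum>n\<le>2^K. euler_log n)" for K
    unfolding dyadic_log_def by (rule sum_dyadic_blocks) auto
  ultimately show ?thesis unfolding sum_subtractf harm by (simp add: add.commute)
qed

text \<open>Enclose N between consecutive powers of two and use monotonicity of the sum. As ln (2^K)
  = K ln 2, replacing ln K by ln (ln N) removes the term ln (ln 2).\<close>

lemma mertens_log:
  "(\<lambda>N. (\<Sum>n\<le>N. euler_log n) - ln (ln (real N))) \<longlonglongrightarrow> euler_mascheroni"
proof (rule tendsto_sandwich)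
  define A where "A = (\<lambda>N. \<Sum>n\<le>N. euler_log n)"
  \<comment> \<open>\<open>lo\<close> pairs the smaller power of two with the larger logarithm and
    \<open>hi\<close> the reverse; each is split into the dyadic limit and an elementary correction
    tending to - ln (ln 2).\<close>
  define lo where "lo = (\<lambda>K. (A (2^K) - ln (real K)) + (ln (real K) - ln (real (Suc K) * ln 2)))"
  define hi where "hi = (\<lambda>K. (A (2^Suc K) - ln (real (Suc K))) + (ln (real (Suc K)) - ln (real K * ln 2)))"
  have floor_log_top: "filterlim floor_log at_top sequentially"
    unfolding filterlim_at_top
    by (metis eventually_at_top_linorder floor_log_le_iff floor_log_power)
  have A_mono: "A m \<le> A n" if "m \<le> n" for m n
    unfolding A_def using that by (intro sum_mono2) (auto simp: euler_log_nonneg)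
  have "lo \<longlonglongrightarrow> (euler_mascheroni + ln (ln 2)) + - ln (ln 2)"
    unfolding lo_def A_def by (intro tendsto_add mertens_dyadic) real_asymp
  then show "(\<lambda>N. lo (floor_log N)) \<longlonglongrightarrow> euler_mascheroni"
    by (intro filterlim_compose[OF _ floor_log_top]) simp
  have "hi \<longlonglongrightarrow> (euler_mascheroni + ln (ln 2)) + - ln (ln 2)"
    unfolding hi_def A_def by (intro tendsto_add LIMSEQ_Suc[OF mertens_dyadic]) real_asymp
  then show "(\<lambda>N. hi (floor_log N)) \<longlonglongrightarrow> euler_mascheroni"
    by (intro filterlim_compose[OF _ floor_log_top]) simp
  have bounds: "real (floor_log N) * ln 2 \<le> ln (real N)" "ln (real N) \<le> real (Suc (floor_log N)) * ln 2"
      "2 ^ floor_log N \<le> N" "N \<le> 2 ^ Suc (floor_log N)" "floor_log N \<ge> 1" if "N \<ge> 2" for N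
  proof -
    show le: "2 ^ floor_log N \<le> N" using that by (intro floor_log_exp2_le) auto
    show ge: "N \<le> 2 ^ Suc (floor_log N)" using floor_log_exp2_gt[of N] by simp
    show "floor_log N \<ge> 1" using floor_log_le_iff[OF that] floor_log_power[of 1] by simp
    have "ln (real (2 ^ floor_log N)) \<le> ln (real N)" using le that by (intro ln_mono) auto
    then show "real (floor_log N) * ln 2 \<le> ln (real N)" by (simp add: ln_realpow)
    have "ln (real N) \<le> ln (real (2 ^ Suc (floor_log N)))"
      using ge that by (intro ln_mono) (auto simp del: power_Suc of_nat_power)
    then show "ln (real N) \<le> real (Suc (floor_log N)) * ln 2"
      by (simp only: of_nat_power of_nat_numeral ln_realpow zero_less_numeral)
  qed
  show "\<forall>\<^sub>F N in sequentially. lo (floor_log N) \<le> (\<Sum>n\<le>N. euler_log n) - ln (ln (real N))"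
    using eventually_ge_at_top[of 2]
  proof eventually_elim
    case (elim N)
    have "ln (ln (real N)) \<le> ln (real (Suc (floor_log N)) * ln 2)"
      using bounds[OF elim] elim by (intro ln_mono) auto
    then show ?case using A_mono[OF bounds(3)[OF elim]] by (simp add: lo_def A_def)
  qed
  show "\<forall>\<^sub>F N in sequentially. (\<Sum>n\<le>N. euler_log n) - ln (ln (real N)) \<le> hi (floor_log N)"
    using eventually_ge_at_top[of 2]
  proof eventually_elim
    case (elim N)
    have "ln (real (floor_log N) * ln 2) \<le> ln (ln (real N))"
      using bounds[OF elim] elim by (intro ln_mono mult_pos_pos) auto
    then show ?case using A_mono[OF bounds(4)[OF elim]] by (simp add: hi_def A_def)
  qed
qed

lemma mertens_third:
  "(\<lambda>N. exp (\<Sum>n\<le>N. euler_log n) / ln (real N)) \<longlonglongrightarrow> exp euler_mascheroni"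
proof -
  have "(\<lambda>N. exp ((\<Sum>n\<le>N. euler_log n) - ln (ln (real N)))) \<longlonglongrightarrow> exp euler_mascheroni"
    by (intro tendsto_exp mertens_log)
  moreover have "\<forall>\<^sub>F N in sequentially. exp ((\<Sum>n\<le>N. euler_log n) - ln (ln (real N)))
      = exp (\<Sum>n\<le>N. euler_log n) / ln (real N)"
    using eventually_ge_at_top[of 2] by eventually_elim (simp add: exp_diff)
  ultimately show ?thesis by (rule Lim_transform_eventually)
qed

section \<open>Regular integers and the limit superior\<close>

text \<open>Solve a x = 1 modulo m = n / gcd(a, n). Then in a (a x - 1) the first factor supplies
  gcd(a, n) and the second supplies m.\<close>

lemma regular_mod_squarefree:
  assumes "squarefree n"
  shows "regular_mod (int n) a"
proof -
  have "n > 0" using assms by (auto intro: Nat.gr0I)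
  define g where "g = gcd a (int n)"
  obtain m where m: "int n = g * m" unfolding g_def by (metis dvd_def gcd_dvd2)
  have "coprime a m"
  proof -
    \<comment> \<open>A common divisor of a and m divides n, hence g, so its square divides g m =
      n.\<close>
    have "gcd a m dvd int n" unfolding m by (rule dvd_mult) (rule gcd_dvd2)
    then have "gcd a m dvd g" unfolding g_def by (intro gcd_greatest gcd_dvd1)
    then have "(gcd a m)\<^sup>2 dvd int n"
      unfolding m power2_eq_square by (rule mult_dvd_mono) (rule gcd_dvd2)
    then have "int ((nat (gcd a m))\<^sup>2) dvd int n" by simp
    then have "(nat (gcd a m))\<^sup>2 dvd n" by (simp only: int_dvd_int_iff)
    then have "is_unit (nat (gcd a m))" using assms squarefreeD by blast
    then show ?thesis by (simp add: coprime_iff_gcd_eq_1 nat_eq_iff)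
  qed
  then obtain x where "[a * x = 1] (mod m)" using cong_solve_coprime_int by blast
  then have "m dvd a * x - 1" by (simp add: cong_iff_dvd_diff)
  moreover have "g dvd a" by (simp add: g_def)
  ultimately have "int n dvd a * (a * x - 1)" unfolding m by (rule mult_dvd_mono[rotated])
  then have "[a\<^sup>2 * x = a] (mod int n)"
    by (simp add: cong_iff_dvd_diff algebra_simps power2_eq_square)
  then show ?thesis unfolding regular_mod_def by blast
qed

lemma varrho_le: "varrho n \<le> n"
proof -
  have "varrho n \<le> card {1..int n}" unfolding varrho_def by (intro card_mono) auto
  then show ?thesis by simp
qed

lemma varrho_squarefree:
  assumes "squarefree n"
  shows "varrho n = n"
proof -
  have "{a \<in> {1..int n}. regular_mod (int n) a} = {1..int n}"
    using regular_mod_squarefree[OF assms] by auto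
  then show ?thesis by (simp only: varrho_def) simp
qed

lemma squarefree_primorial: "squarefree (primorial n)"
  unfolding primorial_def
  by (rule squarefree_prod_coprime) (auto intro: primes_coprime squarefree_prime)

lemma prime_factors_primorial: "prime_factors (primorial n) = {p. prime p \<and> p \<le> n}"
proof -
  have "p dvd primorial n \<longleftrightarrow> p \<le> n" if "prime p" for p
    using that unfolding primorial_def
    by (subst prime_dvd_prod_iff) (auto dest: primes_dvd_imp_eq)
  then show ?thesis using primorial_pos[of n] by (auto simp: prime_factors_dvd)
qed

lemma primorial_at_top: "filterlim primorial at_top sequentially"
  unfolding filterlim_at_top
proof
  fix Z :: nat
  obtain p where p: "prime p" "Z < p" using bigger_prime by blast
  have "Z \<le> primorial n" if "n \<ge> p" for n
  proof -
    have "p \<in> prime_factors (primorial n)" using p that by (simp add: prime_factors_primorial)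
    then have "p \<le> primorial n" using primorial_pos[of n] by (intro dvd_imp_le) auto
    with p show ?thesis by simp
  qed
  then show "\<forall>\<^sub>F n in sequentially. Z \<le> primorial n"
    using eventually_at_top_linorder by blast
qed

section \<open>Bounds for the ratio n / \<phi>(n)\<close>

lemma div_totient_eq:
  assumes "n > 0"
  shows "real n / real (totient n) = exp (\<Sum>p\<in>prime_factors n. euler_log p)"
proof -
  have "exp (\<Sum>p\<in>prime_factors n. euler_log p) = (\<Prod>p\<in>prime_factors n. inverse (1 - 1 / real p))"
    unfolding exp_sum[OF finite_set_mset]
  proof (rule prod.cong)
    fix p assume "p \<in> prime_factors n"
    then have "prime p" by auto
    moreover from this have "1 - 1 / real p > 0" using prime_gt_1_nat[of p] by simp
    ultimately show "exp (euler_log p) = inverse (1 - 1 / real p)"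
      by (simp add: euler_log_def exp_minus)
  qed auto
  also have "\<dots> = inverse (\<Prod>p\<in>prime_factors n. 1 - 1 / real p)"
    using prod_inversef[of "\<lambda>p. 1 - 1 / real p" "prime_factors n"] by (simp add: comp_def)
  finally show ?thesis using assms unfolding totient_formula2 by (simp add: field_simps)
qed

lemma totient_primorial:
  "real (primorial n) / real (totient (primorial n)) = exp (\<Sum>k\<le>n. euler_log k)"
  using div_totient_eq[OF primorial_pos] sum_euler_log_eq[of "\<lambda>_. 1" n]
  by (simp add: prime_factors_primorial)

text \<open>The product of the primes in \<open>P\<close> divides n and is at least
  \<open>L ^ card P\<close>.\<close>

lemma card_large_prime_factors:
  assumes "n > 0" "L > 1" "\<And>p. p \<in> P \<Longrightarrow> real p \<ge> L" "P \<subseteq> prime_factors n"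
  shows "real (card P) * ln L \<le> ln (real n)"
proof -
  have fin: "finite P" using assms(4) finite_subset by auto
  have "L ^ card P \<le> (\<Prod>p\<in>P. real p)"
    unfolding prod_constant [symmetric] using assms by (intro prod_mono) auto
  also have "(\<Prod>p\<in>P. real p) = real (\<Prod>P)" by simp
  also have "\<dots> \<le> real n"
    using prod_primes_dvd[OF fin, of n] assms by (intro of_nat_mono dvd_imp_le) auto
  finally have "ln (L ^ card P) \<le> ln (real n)" using assms by (intro ln_mono) auto
  then show ?thesis using assms by (simp add: ln_realpow)
qed

text \<open>Split the prime factors at L = ln n. The small ones are bounded by the full sum over
  primes up to L; there are at most L / ln L large ones, each contributing at most - ln (1 - 1/L),
  in total O(1 / ln L).\<close>

lemma div_totient_le:
  assumes "n > 0" "ln (real n) > 1"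
  defines "L \<equiv> ln (real n)"
  shows "real n / real (totient n)
       \<le> exp (\<Sum>k\<le>nat \<lfloor>L\<rfloor>. euler_log k) * (1 / (1 - 1 / L)) powr (L / ln L)"
proof -
  let ?small = "{p \<in> prime_factors n. p \<le> nat \<lfloor>L\<rfloor>}"
  let ?large = "{p \<in> prime_factors n. \<not> p \<le> nat \<lfloor>L\<rfloor>}"
  have L: "L > 1" using assms by simp
  have large: "real p \<ge> L" if "p \<in> ?large" for p
    using that L by simp linarith
  have "(\<Sum>p\<in>prime_factors n. euler_log p) = (\<Sum>p\<in>?small. euler_log p) + (\<Sum>p\<in>?large. euler_log p)"
    by (subst sum.union_disjoint [symmetric]) (auto intro: sum.cong)
  moreover have "(\<Sum>p\<in>?small. euler_log p) \<le> (\<Sum>k\<le>nat \<lfloor>L\<rfloor>. euler_log k)"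
    by (intro sum_mono2) (auto simp: euler_log_nonneg)
  moreover have "(\<Sum>p\<in>?large. euler_log p) \<le> L / ln L * - ln (1 - 1 / L)"
  proof -
    have "(\<Sum>p\<in>?large. euler_log p) \<le> real (card ?large) * - ln (1 - 1 / L)"
    proof (rule sum_bounded_above)
      fix p assume p: "p \<in> ?large"
      have "1 / real p \<le> 1 / L" using large[OF p] L by (intro divide_left_mono) auto
      moreover have "1 / L < 1" using L by simp
      ultimately have "ln (1 - 1 / L) \<le> ln (1 - 1 / real p)" by (intro ln_mono) auto
      then show "euler_log p \<le> - ln (1 - 1 / L)" using p by (auto simp: euler_log_def)
    qed
    also have "\<dots> \<le> L / ln L * - ln (1 - 1 / L)"
    proof (rule mult_right_mono)
      show "real (card ?large) \<le> L / ln L"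
      proof -
        have "real (card ?large) * ln L \<le> ln (real n)"
          by (rule card_large_prime_factors[OF assms(1) L]) (fact large, blast)
        then show ?thesis using L by (simp add: pos_le_divide_eq L_def)
      qed
      show "0 \<le> - ln (1 - 1 / L)" using L by simp
    qed
    finally show ?thesis .
  qed
  ultimately have "exp (\<Sum>p\<in>prime_factors n. euler_log p)
      \<le> exp ((\<Sum>k\<le>nat \<lfloor>L\<rfloor>. euler_log k) + L / ln L * - ln (1 - 1 / L))"
    unfolding exp_le_cancel_iff by linarith
  moreover have "exp (L / ln L * - ln (1 - 1 / L)) = (1 / (1 - 1 / L)) powr (L / ln L)"
    using L by (simp add: powr_def ln_div)
  ultimately show ?thesis unfolding div_totient_eq[OF assms(1)] by (simp only: exp_add)
qed

text \<open>Used along \<open>primorial\<close>, which tends to infinity but is constant between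
  consecutive primes, so it is no strictly increasing subsequence.\<close>

lemma Limsup_filterlim_le:
  fixes X :: "'a \<Rightarrow> 'b :: complete_linorder"
  assumes "filterlim r G F"
  shows "Limsup F (\<lambda>x. X (r x)) \<le> Limsup G X"
proof -
  have "Limsup F (\<lambda>x. X (r x)) \<le> Limsup (filtermap r F) X" by (rule Limsup_filtermap_ge)
  also have "\<dots> \<le> Limsup G X"
    using assms unfolding Limsup_def filterlim_def le_filter_def
    by (intro INF_superset_mono) auto
  finally show ?thesis .
qed

theorem theorem8:
  shows "limsup (\<lambda>n::nat. ereal (real (varrho n) / (real (totient n) * ln (ln (real n)))))
         = ereal (exp euler_mascheroni)"
proof (rule antisym)
  let ?X = "\<lambda>n. real (varrho n) / (real (totient n) * ln (ln (real n)))"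
  let ?A = "\<lambda>N. \<Sum>k\<le>N. euler_log k"
  define m where "m = (\<lambda>n::nat. nat \<lfloor>ln (real n)\<rfloor>)"
  \<comment> \<open>The bound of \<open>div_totient_le\<close> divided by ln (ln n), arranged as
    three factors: Mertens' quotient at \<open>m n\<close>, the effect of rounding ln n down, and
    the large primes. The last two tend to 1.\<close>
  define Y where "Y = (\<lambda>n. exp (?A (m n)) / ln (real (m n)) * (ln (real (m n)) / ln (ln (real n)))
      * (1 / (1 - 1 / ln (real n))) powr (ln (real n) / ln (ln (real n))))"
  have "filterlim m at_top sequentially" unfolding m_def by real_asymp
  then have "(\<lambda>n. exp (?A (m n)) / ln (real (m n))) \<longlonglongrightarrow> exp euler_mascheroni"
    by (rule filterlim_compose[OF mertens_third])
  moreover have "(\<lambda>n. ln (real (m n)) / ln (ln (real n))) \<longlonglongrightarrow> 1" unfolding m_def by real_asymp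
  moreover have "(\<lambda>n::nat. (1 / (1 - 1 / ln (real n))) powr (ln (real n) / ln (ln (real n)))) \<longlonglongrightarrow> 1"
    by real_asymp
  ultimately have "Y \<longlonglongrightarrow> exp euler_mascheroni * 1 * 1"
    unfolding Y_def by (intro tendsto_mult)
  then have Y_limsup: "limsup (\<lambda>n. ereal (Y n)) = ereal (exp euler_mascheroni)"
    by (intro lim_imp_Limsup) auto
  \<comment> \<open>The threshold 2 makes ln (ln n) positive and the integer part of ln n at least
    2, so the divisions below are by nonzero numbers.\<close>
  have large: "\<forall>\<^sub>F n::nat in sequentially. ln (real n) > 2" by real_asymp
  have "\<forall>\<^sub>F n in sequentially. ereal (?X n) \<le> ereal (Y n)"
    using large
  proof eventually_elim
    case (elim n)
    define L where "L = ln (real n)"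
    have L: "L > 2" "n > 0" using elim by (auto simp: L_def intro: Nat.gr0I)
    then have lnL: "ln L > 0" by simp
    have "m n \<ge> 2" using L by (simp add: m_def L_def [symmetric] le_nat_floor)
    then have lnm: "ln (real (m n)) \<noteq> 0" by simp
    have "?X n = real (varrho n) / real (totient n) / ln L" by (simp add: L_def)
    also have "\<dots> \<le> real n / real (totient n) / ln L"
      using lnL varrho_le[of n] by (intro divide_right_mono) auto
    also have "\<dots> \<le> exp (?A (m n)) * (1 / (1 - 1 / L)) powr (L / ln L) / ln L"
      using div_totient_le[of n] L lnL unfolding m_def L_def by (intro divide_right_mono) auto
    also have "\<dots> = Y n" using lnm by (simp add: Y_def L_def [symmetric])
    finally show ?case by simp
  qed
  then have "limsup (\<lambda>n. ereal (?X n)) \<le> limsup (\<lambda>n. ereal (Y n))" by (rule Limsup_mono)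
  with Y_limsup show "limsup (\<lambda>n. ereal (?X n)) \<le> ereal (exp euler_mascheroni)" by simp

  \<comment> \<open>The lower bound along primorials: their logarithm is at most N ln 4, and putting
    N ln 4 for N inside the logarithm changes Mertens' quotient only by a factor tending to
    1.\<close>
  define W where "W = (\<lambda>N. exp (?A N) / ln (real N) * (ln (real N) / ln (real N * ln 4)))"
  have "(\<lambda>N::nat. ln (real N) / ln (real N * ln 4)) \<longlonglongrightarrow> 1" by real_asymp
  then have "W \<longlonglongrightarrow> exp euler_mascheroni * 1"
    unfolding W_def by (intro tendsto_mult mertens_third)
  then have W_limsup: "limsup (\<lambda>N. ereal (W N)) = ereal (exp euler_mascheroni)"
    by (intro lim_imp_Limsup) auto
  have "\<forall>\<^sub>F N in sequentially. ln (real (primorial N)) > 2"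
    using primorial_at_top large by (rule eventually_compose_filterlim[rotated])
  then have "\<forall>\<^sub>F N in sequentially. ereal (W N) \<le> ereal (?X (primorial N))"
    using eventually_ge_at_top[of 2]
  proof eventually_elim
    case (elim N)
    let ?P = "primorial N"
    have "real ?P \<le> 4 ^ N" using primorial_le[of N] by (simp flip: of_nat_le_iff)
    then have "ln (real ?P) \<le> ln (4 ^ N)" using primorial_pos[of N] by (intro ln_mono) auto
    then have "ln (real ?P) \<le> real N * ln 4" by (simp add: ln_realpow)
    then have "ln (ln (real ?P)) \<le> ln (real N * ln 4)" using elim by (intro ln_mono) auto
    moreover have "ln (ln (real ?P)) > 0" using elim by simp
    ultimately have "exp (?A N) / ln (real N * ln 4) \<le> exp (?A N) / ln (ln (real ?P))"
      by (intro divide_left_mono mult_pos_pos) auto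
    \<comment> \<open>For the squarefree primorial \<open>varrho\<close> takes its maximal value, so
      the ratio to the totient is exactly the Euler product over primes up to N.\<close>
    also have "\<dots> = ?X ?P"
      by (simp add: varrho_squarefree squarefree_primorial totient_primorial [symmetric])
    finally show ?case using elim by (simp add: W_def)
  qed
  then have "limsup (\<lambda>N. ereal (W N)) \<le> limsup (\<lambda>N. ereal (?X (primorial N)))" by (rule Limsup_mono)
  also have "\<dots> \<le> limsup (\<lambda>n. ereal (?X n))" by (rule Limsup_filterlim_le[OF primorial_at_top])
  finally show "ereal (exp euler_mascheroni) \<le> limsup (\<lambda>n. ereal (?X n))" using W_limsup by simp
qed

end
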